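(* Let $X$ be an Asplund space, and let $\Omega\subset X$ be closed around $\bar x\in\Omega$. The set $\Omega$ is semismooth* at $\bar x$ if and only if, for any $\varepsilon>0$, there is a $\delta>0$ such that $$|\langle x^*,x-\bar x\rangle|\le\varepsilon\|x-\bar x\|$$ for all $x\in\Omega\cap B_\delta(\bar x)$ and all $x^*\in N_\Omega(x)$ with $\|x^*\|=1$.
   Context: $B_\delta(\bar x)$ is the open ball with radius $\delta$ and centre $\bar x$. For $\Omega\subset X$, $x\in\Omega$ and $\varepsilon\ge0$, the set of Fréchet $\varepsilon$-normals is $N_{\Omega,\varepsilon}(x)=\{x^*\in X^*: \limsup_{\Omega\ni u\to x,\,u\ne x}\frac{\langle x^*,u-x\rangle}{\|u-x\|}\le\varepsilon\}$, and $N_\Omega(x)=N_{\Omega,0}(x)$ is the Fréchet normal cone. $\Omega$ is semismooth* at $\bar x\in\Omega$ if for every $\varepsilon>0$ there is $\delta>0$ such that $|\langle x^*,x-\bar x\rangle|\le\varepsilon\|x-\bar x\|$ for all $x\in\Omega\cap B_\delta(\bar x)$ and all $x^*\in N_{\Omega,\delta}(x)$ with $\|x^*\|=1$. "Closed around $\bar x$" means that the intersection of $\Omega$ with some closed neighbourhood of $\bar x$ is closed. *)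

theory Defs
  imports "HOL-Analysis.Analysis"
begin

text \<open>Asplund spaces. For a continuous convex function the set of points of Frechet
  differentiability is always \<open>G\<^sub>\<delta>\<close>, so requiring it to be dense is the same as
  requiring it to be a dense \<open>G\<^sub>\<delta>\<close> subset of \<open>U\<close>.\<close>

definition asplund_space :: "'a::banach itself \<Rightarrow> bool" where
  "asplund_space (_ :: 'a itself) \<longleftrightarrow>
    (\<forall>(U :: 'a set) (f :: 'a \<Rightarrow> real).
       open U \<and> convex U \<and> convex_on U f \<and> continuous_on U f \<longrightarrow>
       U \<subseteq> closure {x \<in> U. f differentiable (at x)})"

definition closed_around :: "'a::topological_space set \<Rightarrow> 'a \<Rightarrow> bool" where
  "closed_around \<Omega> xb \<longleftrightarrow> (\<exists>V. closed V \<and> xb \<in> interior V \<and> closed (\<Omega> \<inter> V))"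

text \<open>The dual space is the type of bounded linear functionals, with its operator norm. The upper
  limit is taken in the extended reals and is \<open>-\<infinity>\<close> when \<open>x\<close> is isolated in \<open>\<Omega>\<close>, so that
  every functional is then a normal. The sets are only meant to be used for \<open>x \<in> \<Omega>\<close>.\<close>

definition frechet_eps_normals ::
    "'a::real_normed_vector set \<Rightarrow> real \<Rightarrow> 'a \<Rightarrow> ('a \<Rightarrow>\<^sub>L real) set" where
  "frechet_eps_normals \<Omega> \<epsilon> x =
    {xs. Limsup (at x within \<Omega>)
           (\<lambda>u. ereal (blinfun_apply xs (u - x) / norm (u - x))) \<le> ereal \<epsilon>}"

definition frechet_normal_cone ::
    "'a::real_normed_vector set \<Rightarrow> 'a \<Rightarrow> ('a \<Rightarrow>\<^sub>L real) set" where
  "frechet_normal_cone \<Omega> x = frechet_eps_normals \<Omega> 0 x"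

text \<open>The same \<open>\<delta>\<close> is the radius of the ball and the tolerance of the normals.\<close>

definition semismooth_star :: "'a::real_normed_vector set \<Rightarrow> 'a \<Rightarrow> bool" where
  "semismooth_star \<Omega> xb \<longleftrightarrow>
    (\<forall>\<epsilon>>0. \<exists>\<delta>>0. \<forall>x \<in> \<Omega> \<inter> ball xb \<delta>. \<forall>xs \<in> frechet_eps_normals \<Omega> \<delta> x.
       norm xs = 1 \<longrightarrow> \<bar>blinfun_apply xs (x - xb)\<bar> \<le> \<epsilon> * norm (x - xb))"

end

theory Submission
  imports Defs
begin

text \<open>Only the passage from \<open>\<delta>\<close>-normals to normals is substantial: in an Asplund space every
  \<open>\<epsilon>\<close>-normal to a closed set is within \<open>\<epsilon> + \<gamma>\<close> of a Frechet normal at a point within \<open>\<gamma>\<close>. By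
  Hahn-Banach, the absence of a normal near a given functional has finite certificates, so the
  search can be confined to a separable closed subset \<open>S\<close>. Every separated family in the dual ball,
  in the seminorm of the directions of \<open>S\<close>, is countable, because otherwise its supremum up to
  countable exceptions would be a convex function without points of Frechet differentiability. A
  dense sequence in the dual ball yields functions uniformly close to the norm that are Frechet
  differentiable from above along \<open>S\<close>. Perturbing by these, a variational principle gives an exact
  minimizer on \<open>S\<close>, at which the negative derivative of the perturbation is a normal.\<close>

section \<open>Hahn-Banach\<close>

text \<open>An Asplund space need not carry an equivalent Frechet-smooth norm, so no smooth
  perturbation is at hand on the whole space. Shrinking the set to a separable part makes one
  available, but a smaller set has more normals; this is what forces the countable set to be closed
  under certificates. Smoothness from above is enough: at a minimizer, an upper linear estimate of
  the minimized function with error o(norm h) cannot drop below the minimum along the admissible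
  increments \<open>h\<close>, and this is precisely the inequality of a normal. In the equivalence,
  the normal must be taken at a point whose distance to \<open>x\<close> is small relative to
  \<open>norm (x - xb)\<close>, because the required bound degenerates at \<open>xb\<close>. It is
  then rescaled to unit length, which costs only a bounded factor because the given functional has
  norm one.\<close>

definition sublinear :: "('a::real_vector \<Rightarrow> real) \<Rightarrow> bool" where
  "sublinear p \<longleftrightarrow> (\<forall>x y. p (x + y) \<le> p x + p y) \<and> (\<forall>t x. 0 \<le> t \<longrightarrow> p (t *\<^sub>R x) \<le> t * p x)"

lemma sublinearD:
  assumes "sublinear p"
  shows "p (x + y) \<le> p x + p y" "0 \<le> t \<Longrightarrow> p (t *\<^sub>R x) \<le> t * p x"
    "p 0 = 0" "- p (- x) \<le> p x"
proof -
  show 1: "p (x + y) \<le> p x + p y" "0 \<le> t \<Longrightarrow> p (t *\<^sub>R x) \<le> t * p x" for x y t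
    using assms by (auto simp: sublinear_def)
  show 0: "p 0 = 0"
    using 1(1)[of 0 0] 1(2)[of 0 0] by simp
  show "- p (- x) \<le> p x"
    using 1(1)[of x "- x"] 0 by simp
qed

text \<open>Zorn's lemma yields a minimal sublinear functional below \<open>p\<close>, and
  minimality forces superadditivity, hence linearity.\<close>

lemma sublinear_dominates_linear:
  fixes p :: "'a::real_vector \<Rightarrow> real"
  assumes "sublinear p"
  obtains f where "linear f" "\<And>x. f x \<le> p x"
proof -
  define S where "S = {q. sublinear q \<and> q \<le> p}"
  \<comment> \<open>The order is reversed, so that the maximal element of Zorn's lemma is a minimal
    functional.\<close>
  define P :: "('a \<Rightarrow> real) \<Rightarrow> ('a \<Rightarrow> real) \<Rightarrow> bool" where "P = (\<lambda>q r. r \<le> q)"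
  \<comment> \<open>A lower bound that does not depend on \<open>q\<close> keeps infima over chains
    finite.\<close>
  have bound: "- p (- x) \<le> q x" if "q \<in> S" for q x
    using that sublinearD(4)[of q x] by (auto simp: S_def le_fun_def intro: order_trans[of _ "- q (- x)"])
  have "\<exists>m\<in>S. \<forall>a\<in>S. P m a \<longrightarrow> a = m"
  proof (rule predicate_Zorn)
    show "partial_order_on S (relation_of P S)"
      by (auto simp: P_def intro!: partial_order_on_relation_ofI)
    fix C assume C: "C \<in> Chains (relation_of P S)"
    then have CS: "C \<subseteq> S"
      by (auto simp: Chains_def relation_of_def)
    have cmp: "q \<le> r \<or> r \<le> q" if "q \<in> C" "r \<in> C" for q r
      using C that by (auto simp: Chains_def relation_of_def P_def)
    show "\<exists>u\<in>S. \<forall>a\<in>C. P a u"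
    proof (cases "C = {}")
      case True
      then show ?thesis using assms by (auto simp: S_def)
    next
      case False
      define u where "u = (\<lambda>x. INF q\<in>C. q x)"
      have bdd: "bdd_below ((\<lambda>q. q x) ` C)" for x
        using bound CS by (auto intro!: bdd_belowI[of _ "- p (- x)"])
      have low: "u x \<le> q x" if "q \<in> C" for q x
        unfolding u_def by (rule cINF_lower[OF bdd that])
      have "u (x + y) \<le> u x + u y" for x y
      proof -
        have *: "u (x + y) \<le> q x + r y" if qr: "q \<in> C" "r \<in> C" for q r
        proof -
          obtain s where s: "s \<in> C" "s \<le> q" "s \<le> r"
            using cmp[OF qr] qr by auto
          have "sublinear s" using s(1) CS by (auto simp: S_def)
          then have "u (x + y) \<le> s x + s y"
            using low[OF s(1), of "x + y"] sublinearD(1)[of s x y] by linarith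
          also have "\<dots> \<le> q x + r y"
            using s by (intro add_mono) (auto simp: le_fun_def)
          finally show ?thesis .
        qed
        have "u (x + y) - r y \<le> u x" if "r \<in> C" for r
          unfolding u_def[of] using *[OF _ that] False
          by (intro cINF_greatest) (auto simp: algebra_simps u_def)
        then have "u (x + y) - u x \<le> r y" if "r \<in> C" for r
          using that by (force simp: algebra_simps)
        then have "u (x + y) - u x \<le> u y"
          unfolding u_def[THEN fun_cong, of y] using False by (intro cINF_greatest) auto
        then show ?thesis by simp
      qed
      moreover have "u (t *\<^sub>R x) \<le> t * u x" if "0 \<le> t" for t x
      proof (cases "t = 0")
        case True
        obtain q where "q \<in> C" using False by auto
        then have "u 0 \<le> q 0" "q 0 = 0"
          using low CS sublinearD(3)[of q] by (auto simp: S_def)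
        then show ?thesis using True by simp
      next
        case False
        then have t: "t > 0" using that by simp
        have "u (t *\<^sub>R x) / t \<le> q x" if "q \<in> C" for q
        proof -
          have "u (t *\<^sub>R x) \<le> t * q x"
            using low[OF that, of "t *\<^sub>R x"] sublinearD(2)[of q t x] t that CS
            by (force simp: S_def)
          then show ?thesis using t by (simp add: field_simps)
        qed
        then have "u (t *\<^sub>R x) / t \<le> u x"
          unfolding u_def[THEN fun_cong, of x] using \<open>C \<noteq> {}\<close> by (intro cINF_greatest) auto
        then show ?thesis using t by (simp add: field_simps)
      qed
      ultimately have "sublinear u" by (simp add: sublinear_def)
      moreover have "u \<le> p"
      proof -
        obtain q where "q \<in> C" using False by auto
        then show ?thesis using low[of q] CS by (auto simp: S_def le_fun_def intro: order_trans)
      qed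
      ultimately show ?thesis using low by (auto simp: S_def P_def le_fun_def)
    qed
  qed
  then obtain m where m: "sublinear m" "m \<le> p" and min: "\<And>q. sublinear q \<Longrightarrow> q \<le> m \<Longrightarrow> q = m"
    by (force simp: S_def P_def)
  have super: "m x + m y \<le> m (x + y)" for x y
  proof -
    \<comment> \<open>The infimum trades multiples of \<open>y\<close>: \<open>t = 0\<close> puts
      \<open>q\<close> below \<open>m\<close>, so minimality gives \<open>q = m\<close>, and
      \<open>t = 1\<close> then reads \<open>m x \<le> m (x + y) - m y\<close>.\<close>
    define q where "q = (\<lambda>x. INF t\<in>{0..}. m (x + t *\<^sub>R y) - t * m y)"
    have bdd: "bdd_below ((\<lambda>t. m (x + t *\<^sub>R y) - t * m y) ` {0..})" for x
    proof (rule bdd_belowI2)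
      fix t :: real assume "t \<in> {0..}"
      then show "- m (- x) \<le> m (x + t *\<^sub>R y) - t * m y"
        using sublinearD(1)[OF m(1), of "- x" "x + t *\<^sub>R y"] sublinearD(4)[OF m(1), of x]
          sublinearD(2)[OF m(1), of t y] sublinearD(2)[OF m(1), of "1 / t" "t *\<^sub>R y"] sublinearD(3)[OF m(1)]
        by (cases "t = 0") (auto simp: field_simps)
    qed
    have low: "q x \<le> m (x + t *\<^sub>R y) - t * m y" if "0 \<le> t" for x t
      unfolding q_def using that by (intro cINF_lower bdd) auto
    have "q (x + z) \<le> q x + q z" for x z
    proof -
      have *: "q (x + z) \<le> (m (x + t *\<^sub>R y) - t * m y) + (m (z + r *\<^sub>R y) - r * m y)"
        if "0 \<le> t" "0 \<le> r" for t r
        using low[of "t + r" "x + z"] sublinearD(1)[OF m(1), of "x + t *\<^sub>R y" "z + r *\<^sub>R y"] that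
        by (auto simp: algebra_simps)
      have "q (x + z) - (m (z + r *\<^sub>R y) - r * m y) \<le> q x" if "0 \<le> r" for r
        unfolding q_def[THEN fun_cong, of x] using *[OF _ that]
        by (intro cINF_greatest) (auto simp: algebra_simps)
      then have "q (x + z) - q x \<le> m (z + r *\<^sub>R y) - r * m y" if "0 \<le> r" for r
        using that by (force simp: algebra_simps)
      then have "q (x + z) - q x \<le> q z"
        unfolding q_def[THEN fun_cong, of z] by (intro cINF_greatest) auto
      then show ?thesis by simp
    qed
    moreover have "q (t *\<^sub>R x) \<le> t * q x" if "0 \<le> t" for t x
    proof (cases "t = 0")
      case True
      then show ?thesis using low[of 0 0] sublinearD(3)[OF m(1)] by simp
    next
      case False
      then have t: "t > 0" using that by simp
      have "q (t *\<^sub>R x) / t \<le> m (x + r *\<^sub>R y) - r * m y" if "0 \<le> r" for r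
      proof -
        have "q (t *\<^sub>R x) \<le> t * (m (x + r *\<^sub>R y) - r * m y)"
          using low[of "t * r" "t *\<^sub>R x"] sublinearD(2)[OF m(1), of t "x + r *\<^sub>R y"] t that
          by (auto simp: algebra_simps)
        then show ?thesis using t by (simp add: field_simps)
      qed
      then have "q (t *\<^sub>R x) / t \<le> q x"
        unfolding q_def[THEN fun_cong, of x] by (intro cINF_greatest) auto
      then show ?thesis using t by (simp add: field_simps)
    qed
    ultimately have "sublinear q" by (simp add: sublinear_def)
    moreover have "q \<le> m" using low[of 0] by (auto simp: le_fun_def)
    ultimately have "q = m" by (rule min)
    then show ?thesis using low[of 1 x] by simp
  qed
  then have add: "m (x + y) = m x + m y" for x y
    using sublinearD(1)[OF m(1)] by (simp add: antisym)
  have neg: "m (- x) = - m x" for x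
    using add[of x "- x"] sublinearD(3)[OF m(1)] by simp
  have pos: "m (t *\<^sub>R x) = t * m x" if "0 \<le> t" for t x
    using sublinearD(2)[OF m(1) that, of x] sublinearD(2)[OF m(1) that, of "- x"] neg by simp
  have "linear m"
  proof (rule linearI)
    show "m (t *\<^sub>R x) = t *\<^sub>R m x" for t x
    proof (cases "0 \<le> t")
      case False
      then show ?thesis using pos[of "- t" x] neg[of "t *\<^sub>R x"] by simp
    qed (use pos in simp)
  qed (rule add)
  then show ?thesis using that m(2) by (auto simp: le_fun_def)
qed

text \<open>This is the Mazur-Orlicz form of the Hahn-Banach theorem.\<close>

lemma bounded_functional_exists:
  fixes C :: "('a::real_normed_vector \<times> real) set"
  assumes pos: "\<And>k c. (k, c) \<in> convex hull C \<Longrightarrow> 0 \<le> \<eta> * norm k + c"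
    and \<eta>: "0 \<le> \<eta>"
  obtains w :: "'a \<Rightarrow>\<^sub>L real" where "norm w \<le> \<eta>" "\<And>k c. (k, c) \<in> C \<Longrightarrow> w k \<le> c"
proof -
  \<comment> \<open>The convex cone generated by \<open>C\<close>: homogeneity carries the
    hypothesis from the hull to the cone, and the inserted \<open>0\<close> covers an empty
    \<open>C\<close>.\<close>
  define K where "K = insert 0 (cone hull (convex hull C))"
  have K0: "0 \<in> K" by (simp add: K_def)
  have K: "K = insert 0 {t *\<^sub>R z | t z. 0 \<le> t \<and> z \<in> convex hull C}"
    by (auto simp: K_def cone_hull_expl)
  have scale: "t *\<^sub>R z \<in> K" if "z \<in> K" "0 \<le> t" for t z
    using that unfolding K by (auto simp del: scaleR_Pair) (metis mult_nonneg_nonneg scaleR_scaleR)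
  have add: "y + z \<in> K" if yz: "y \<in> K" "z \<in> K" for y z
  proof (cases "y = 0 \<or> z = 0")
    case False
    with yz have *: "y \<in> cone hull (convex hull C)" "z \<in> cone hull (convex hull C)"
      by (auto simp: K_def)
    have "convex (cone hull (convex hull C))"
      by (intro convex_cone_hull convex_convex_hull)
    then have "y + z \<in> cone hull (convex hull C)"
      using * by (meson cone_cone_hull convex_cone)
    then show ?thesis by (simp add: K_def)
  qed (use yz in auto)
  have K_pos: "0 \<le> \<eta> * norm k + c" if kc: "(k, c) \<in> K" for k c
  proof (cases "(k, c) = 0")
    case False
    then obtain t k' c' where t: "0 \<le> t" "(k', c') \<in> convex hull C" "k = t *\<^sub>R k'" "c = t * c'"
      using kc unfolding K by auto
    have "0 \<le> t * (\<eta> * norm k' + c')"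
      using pos t by simp
    then show ?thesis using t by (simp add: algebra_simps)
  qed (auto simp: zero_prod_def)
  \<comment> \<open>A linear functional below this infimum has both required properties:
    \<open>z = 0\<close> gives the norm bound, and \<open>x = k\<close> with
    \<open>z = (k, c)\<close> gives the bound \<open>c\<close> at \<open>k\<close>.\<close>
  define p where "p = (\<lambda>x. INF z\<in>K. \<eta> * norm (x - fst z) + snd z)"
  have bdd: "bdd_below ((\<lambda>z. \<eta> * norm (x - fst z) + snd z) ` K)" for x
  proof (rule bdd_belowI2)
    fix z assume "z \<in> K"
    then have "0 \<le> \<eta> * norm (fst z) + snd z" using K_pos[of "fst z" "snd z"] by simp
    moreover have "\<eta> * norm (fst z) \<le> \<eta> * (norm (x - fst z) + norm x)"
      using \<eta> norm_triangle_ineq4[of "x" "x - fst z"] by (intro mult_left_mono) auto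
    ultimately show "- (\<eta> * norm x) \<le> \<eta> * norm (x - fst z) + snd z"
      by (simp add: algebra_simps)
  qed
  have low: "p x \<le> \<eta> * norm (x - fst z) + snd z" if "z \<in> K" for x z
    unfolding p_def by (rule cINF_lower[OF bdd that])
  have ne: "K \<noteq> {}" using K0 by auto
  have "p (x + y) \<le> p x + p y" for x y
  proof -
    have *: "p (x + y) \<le> (\<eta> * norm (x - fst z) + snd z) + (\<eta> * norm (y - fst w) + snd w)"
      if "z \<in> K" "w \<in> K" for z w
    proof -
      have "\<eta> * norm (x + y - fst (z + w)) \<le> \<eta> * (norm (x - fst z) + norm (y - fst w))"
        using \<eta> norm_triangle_ineq[of "x - fst z" "y - fst w"]
        by (intro mult_left_mono) (auto simp: algebra_simps)
      then show ?thesis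
        using low[OF add[OF that], of "x + y"] by (simp add: algebra_simps)
    qed
    have "p (x + y) - (\<eta> * norm (y - fst w) + snd w) \<le> p x" if "w \<in> K" for w
      unfolding p_def[THEN fun_cong, of x] using *[OF _ that] ne
      by (intro cINF_greatest) (auto simp: algebra_simps)
    then have "p (x + y) - p x \<le> \<eta> * norm (y - fst w) + snd w" if "w \<in> K" for w
      using that by (force simp: algebra_simps)
    then have "p (x + y) - p x \<le> p y"
      unfolding p_def[THEN fun_cong, of y] using ne by (intro cINF_greatest) auto
    then show ?thesis by simp
  qed
  moreover have "p (t *\<^sub>R x) \<le> t * p x" if "0 \<le> t" for t x
  proof (cases "t = 0")
    case True
    then show ?thesis using low[OF K0, of 0] by simp
  next
    case False
    then have t: "t > 0" using that by simp
    have "p (t *\<^sub>R x) / t \<le> \<eta> * norm (x - fst z) + snd z" if "z \<in> K" for z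
    proof -
      have "p (t *\<^sub>R x) \<le> \<eta> * norm (t *\<^sub>R (x - fst z)) + t * snd z"
        using low[OF scale[OF that, of t], of "t *\<^sub>R x"] t by (simp add: scaleR_diff_right)
      also have "\<dots> = t * (\<eta> * norm (x - fst z) + snd z)"
        using t unfolding norm_scaleR by (simp add: distrib_left)
      finally show ?thesis using t by (simp add: pos_divide_le_eq mult.commute)
    qed
    then have "p (t *\<^sub>R x) / t \<le> p x"
      unfolding p_def[THEN fun_cong, of x] using ne by (intro cINF_greatest) auto
    then show ?thesis using t by (simp add: field_simps)
  qed
  ultimately have "sublinear p" by (simp add: sublinear_def)
  then obtain f where f: "linear f" "\<And>x. f x \<le> p x"
    by (rule sublinear_dominates_linear) blast
  have up: "f x \<le> \<eta> * norm x" for x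
    using f(2)[of x] low[OF K0, of x] by simp
  have ab: "\<bar>f x\<bar> \<le> norm x * \<eta>" for x
    using up[of x] up[of "- x"] linear_neg[OF f(1), of x] by (simp add: abs_le_iff mult.commute)
  have bl: "bounded_linear f"
    using f(1) ab by (auto simp: bounded_linear_def bounded_linear_axioms_def)
  show ?thesis
  proof (rule that[of "Blinfun f"])
    show "norm (Blinfun f) \<le> \<eta>"
      using ab \<eta> by (intro norm_blinfun_bound) (auto simp: bounded_linear_Blinfun_apply[OF bl] mult.commute)
    fix k c assume "(k, c) \<in> C"
    then have "(k, c) \<in> K"
      unfolding K using hull_inc[of "(k, c)" C convex] by (metis (mono_tags, lifting) insertI2 mem_Collect_eq scaleR_one zero_le_one)
    then show "Blinfun f k \<le> c"
      using f(2)[of k] low[of "(k, c)" k] by (simp add: bounded_linear_Blinfun_apply[OF bl])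
  qed
qed

section \<open>Separable reduction of Frechet normals\<close>

text \<open>The filter \<open>at x within A\<close> omits \<open>u = x\<close>, where the inequality
  cleared of its denominator is trivial. At an isolated point both sides hold for every
  functional.\<close>

lemma frechet_eps_normals_iff:
  "xs \<in> frechet_eps_normals A e x \<longleftrightarrow>
    (\<forall>\<eta>>e. \<exists>\<delta>>0. \<forall>u\<in>A. dist u x < \<delta> \<longrightarrow> blinfun_apply xs (u - x) \<le> \<eta> * norm (u - x))"
  (is "_ \<longleftrightarrow> ?R")
proof -
  let ?f = "\<lambda>u. blinfun_apply xs (u - x) / norm (u - x)"
  have "xs \<in> frechet_eps_normals A e x \<longleftrightarrow>
      (\<forall>y>ereal e. \<forall>\<^sub>F u in at x within A. ereal (?f u) < y)"
    by (simp add: frechet_eps_normals_def Limsup_le_iff)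
  also have "\<dots> \<longleftrightarrow> (\<forall>\<eta>>e. \<forall>\<^sub>F u in at x within A. ?f u \<le> \<eta>)"
  proof safe
    fix \<eta> assume "\<forall>y>ereal e. \<forall>\<^sub>F u in at x within A. ereal (?f u) < y" "e < \<eta>"
    then have "\<forall>\<^sub>F u in at x within A. ereal (?f u) < ereal \<eta>" by (metis less_ereal.simps(1))
    then show "\<forall>\<^sub>F u in at x within A. ?f u \<le> \<eta>" by (rule eventually_mono) auto
  next
    fix y assume *: "\<forall>\<eta>>e. \<forall>\<^sub>F u in at x within A. ?f u \<le> \<eta>" and y: "ereal e < y"
    obtain \<eta> where \<eta>: "ereal e < ereal \<eta>" "ereal \<eta> < y"
      using ereal_dense2[OF y] by blast
    then have "\<forall>\<^sub>F u in at x within A. ?f u \<le> \<eta>" using * by auto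
    then show "\<forall>\<^sub>F u in at x within A. ereal (?f u) < y"
      by (rule eventually_mono) (meson \<eta>(2) ereal_less_eq(3) le_less_trans)
  qed
  also have "\<dots> \<longleftrightarrow> ?R"
  proof -
    have *: "(u \<noteq> x \<longrightarrow> ?f u \<le> \<eta>) \<longleftrightarrow> blinfun_apply xs (u - x) \<le> \<eta> * norm (u - x)" for u \<eta>
      by (cases "u = x") (auto simp: pos_divide_le_eq)
    have "(\<forall>\<^sub>F u in at x within A. ?f u \<le> \<eta>) \<longleftrightarrow>
        (\<exists>\<delta>>0. \<forall>u\<in>A. dist u x < \<delta> \<longrightarrow> blinfun_apply xs (u - x) \<le> \<eta> * norm (u - x))" for \<eta>
      unfolding eventually_at * [symmetric] by blast
    then show ?thesis by simp
  qed
  finally show ?thesis .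
qed

lemma frechet_normal_coneD:
  assumes "a \<in> frechet_normal_cone A x" "0 < \<eta>"
  obtains \<delta> where "0 < \<delta>" "\<And>u. u \<in> A \<Longrightarrow> dist u x < \<delta> \<Longrightarrow> blinfun_apply a (u - x) \<le> \<eta> * norm (u - x)"
  using assms(1)[unfolded frechet_normal_cone_def frechet_eps_normals_iff, rule_format, OF assms(2)] that
  by auto

text \<open>Tolerances \<open>1 / (n + 1)\<close> suffice by the Archimedean property. Indexing them
  by naturals keeps the data recorded by a certificate countable.\<close>

lemma frechet_normal_coneI:
  assumes "\<And>n. \<exists>\<delta>>0. \<forall>u\<in>A. dist u x < \<delta> \<longrightarrow> blinfun_apply a (u - x) \<le> norm (u - x) / (real n + 1)"
  shows "a \<in> frechet_normal_cone A x"
  unfolding frechet_normal_cone_def frechet_eps_normals_iff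
proof safe
  fix \<eta> :: real assume "0 < \<eta>"
  then obtain n where n: "1 / (real n + 1) < \<eta>"
    by (metis reals_Archimedean Suc_eq_plus1 inverse_eq_divide of_nat_Suc add.commute)
  obtain \<delta> where \<delta>: "\<delta> > 0" "\<forall>u\<in>A. dist u x < \<delta> \<longrightarrow> blinfun_apply a (u - x) \<le> norm (u - x) / (real n + 1)"
    using assms by blast
  have "norm (u - x) / (real n + 1) \<le> \<eta> * norm (u - x)" for u
    using mult_right_mono[OF less_imp_le[OF n], of "norm (u - x)"] by simp
  then show "\<exists>\<delta>>0. \<forall>u\<in>A. dist u x < \<delta> \<longrightarrow> blinfun_apply a (u - x) \<le> \<eta> * norm (u - x)"
    using \<delta> by (meson order_trans)
qed

lemma countable_closure_under:
  assumes "countable C0" "\<And>c. countable (G c)"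
  obtains C where "countable C" "C0 \<subseteq> C" "C \<subseteq> C0 \<union> (\<Union>c. G c)" "\<And>c. c \<in> C \<Longrightarrow> G c \<subseteq> C"
proof -
  define H where "H = (\<lambda>n. ((\<lambda>S. S \<union> (\<Union>c\<in>S. G c)) ^^ n) C0)"
  have H: "H 0 = C0" "H (Suc n) = H n \<union> (\<Union>c\<in>H n. G c)" for n
    by (simp_all add: H_def)
  have "countable (H n)" for n
    by (induction n) (use assms H in auto)
  moreover have "H n \<subseteq> C0 \<union> (\<Union>c. G c)" for n
    by (induction n) (use H in auto)
  ultimately show ?thesis
    using H by (intro that[of "\<Union>n. H n"]) (auto, blast+)
qed

lemma positive_lower_bound:
  fixes g :: "nat \<Rightarrow> real"
  assumes "\<And>n. n < N \<Longrightarrow> 0 < g n"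
  obtains d where "0 < d" "\<And>n. n < N \<Longrightarrow> d \<le> g n"
proof (cases "N = 0")
  case False
  then show ?thesis
    using assms by (intro that[of "Min (g ` {..<N})"]) (subst Min_gr_iff, auto)
qed (use that[of 1] in auto)

text \<open>A negative gap certifies that no functional within \<open>\<eta>\<close> of \<open>xs\<close> satisfies the inequalities
  \<open>a (v i - c) \<le> norm (v i - c) / (n i + 1)\<close> simultaneously; by Hahn-Banach such finite certificates
  exist whenever there is no normal near \<open>xs\<close>. They survive small changes of the base point \<open>c\<close>,
  so it suffices to choose certificates at the points of a countable set.\<close>

definition gap :: "('a::real_normed_vector \<Rightarrow>\<^sub>L real) \<Rightarrow> real \<Rightarrow> 'a \<Rightarrow> nat \<Rightarrow> (nat \<Rightarrow> real) \<Rightarrow> (nat \<Rightarrow> nat) \<Rightarrow> (nat \<Rightarrow> 'a) \<Rightarrow> real"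
  where "gap xs \<eta> c k l n v = \<eta> * norm (\<Sum>i=1..k. l i *\<^sub>R (v i - c)) +
    (\<Sum>i=1..k. l i * (norm (v i - c) / (real (n i) + 1) - blinfun_apply xs (v i - c)))"

text \<open>Since the weights sum to one, a change of base point shifts the weighted mean of the
  \<open>v i - c\<close> by exactly \<open>u - c\<close>. The constant collects the three terms: at
  most 1 from the scaled norms, \<open>norm xs\<close> from the functional, \<eta> from the norm of
  the mean.\<close>

lemma gap_lipschitz:
  assumes l: "\<And>i. i \<in> {1..k} \<Longrightarrow> 0 \<le> l i" "sum l {1..k} = 1" and \<eta>: "0 \<le> \<eta>"
  shows "gap xs \<eta> c k l n v \<le> gap xs \<eta> u k l n v + (1 + norm xs + \<eta>) * dist c u"
proof -
  have "(\<Sum>i=1..k. l i *\<^sub>R (v i - c)) = (\<Sum>i=1..k. l i *\<^sub>R (v i - u)) + (u - c)"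
  proof -
    have "(\<Sum>i=1..k. l i *\<^sub>R (v i - c)) = (\<Sum>i=1..k. l i *\<^sub>R (v i - u)) + (\<Sum>i=1..k. l i *\<^sub>R (u - c))"
      by (simp add: sum.distrib[symmetric] scaleR_add_right[symmetric])
    then show ?thesis using l(2) by (simp only: scaleR_left.sum[symmetric]) simp
  qed
  then have "norm (\<Sum>i=1..k. l i *\<^sub>R (v i - c)) \<le> norm (\<Sum>i=1..k. l i *\<^sub>R (v i - u)) + dist c u"
    by (metis dist_commute dist_norm norm_triangle_ineq)
  then have 1: "\<eta> * norm (\<Sum>i=1..k. l i *\<^sub>R (v i - c))
      \<le> \<eta> * norm (\<Sum>i=1..k. l i *\<^sub>R (v i - u)) + \<eta> * dist c u"
    using \<eta> by (metis distrib_left mult_left_mono)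
  have "(\<Sum>i=1..k. l i * (norm (v i - c) / (real (n i) + 1) - xs (v i - c)))
      \<le> (\<Sum>i=1..k. l i * ((norm (v i - u) / (real (n i) + 1) - xs (v i - u)) + (1 + norm xs) * dist c u))"
  proof (intro sum_mono mult_left_mono l(1))
    fix i
    have a: "norm (v i - c) \<le> norm (v i - u) + dist c u"
      by (metis dist_commute dist_norm dist_triangle)
    have b: "norm (v i - c) / (real (n i) + 1) \<le> norm (v i - u) / (real (n i) + 1) + dist c u"
    proof -
      have "norm (v i - c) / (real (n i) + 1) \<le> (norm (v i - u) + dist c u) / (real (n i) + 1)"
        using a by (intro divide_right_mono) auto
      also have "\<dots> = norm (v i - u) / (real (n i) + 1) + dist c u / (real (n i) + 1)"
        by (simp add: add_divide_distrib)
      also have "dist c u / (real (n i) + 1) \<le> dist c u"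
        by (simp add: divide_le_eq mult_left_mono algebra_simps)
      finally show ?thesis by simp
    qed
    have "xs (v i - u) - xs (v i - c) = xs (c - u)"
      by (simp add: blinfun.diff_right)
    also have "\<dots> \<le> norm xs * dist c u"
      using norm_blinfun[of xs "c - u"] by (simp add: dist_norm)
    finally show "norm (v i - c) / (real (n i) + 1) - xs (v i - c)
        \<le> norm (v i - u) / (real (n i) + 1) - xs (v i - u) + (1 + norm xs) * dist c u"
      using b by (simp add: algebra_simps)
  qed
  also have "\<dots> = (\<Sum>i=1..k. l i * (norm (v i - u) / (real (n i) + 1) - xs (v i - u)))
      + (1 + norm xs) * dist c u"
    using l(2) by (simp add: distrib_left sum.distrib sum_distrib_right[symmetric])
  finally show ?thesis using 1 unfolding gap_def by (simp add: algebra_simps)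
qed

text \<open>Soundness of certificates: the weighted sum of the inequalities for \<open>a\<close>
  turns into one for \<open>xs\<close> at the price of \<open>(a - xs) z\<close>, and the term with
  \<eta> pays for it.\<close>

lemma gap_nonneg:
  assumes l: "\<And>i. i \<in> {1..k} \<Longrightarrow> 0 \<le> l i"
    and a: "norm (a - xs) \<le> \<eta>"
    and v: "\<And>i. i \<in> {1..k} \<Longrightarrow> blinfun_apply a (v i - u) \<le> norm (v i - u) / (real (n i) + 1)"
  shows "0 \<le> gap xs \<eta> u k l n v"
proof -
  define z where "z = (\<Sum>i=1..k. l i *\<^sub>R (v i - u))"
  have "(xs - a) z \<le> norm (xs - a) * norm z"
    using norm_blinfun[of "xs - a" z] by simp
  also have "\<dots> \<le> \<eta> * norm z"
    using a by (intro mult_right_mono) (auto simp: norm_minus_commute)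
  finally have "0 \<le> \<eta> * norm z + (a - xs) z"
    by (simp add: blinfun.diff_left)
  also have "(a - xs) z = (\<Sum>i=1..k. l i * (a (v i - u) - xs (v i - u)))"
    unfolding z_def by (simp add: blinfun.sum_right blinfun.scaleR_right blinfun.diff_left)
  also have "\<dots> \<le> (\<Sum>i=1..k. l i * (norm (v i - u) / (real (n i) + 1) - xs (v i - u)))"
    using v l by (intro sum_mono mult_left_mono) auto
  finally show ?thesis by (simp add: gap_def z_def)
qed

text \<open>Completeness of certificates: otherwise the Hahn-Banach argument produces a correction
  \<open>w\<close> of norm at most \<eta> for which \<open>xs + w\<close> satisfies the inequality
  with tolerance \<open>1 / (n + 1)\<close> on the ball of radius \<open>\<rho> n\<close>, for every
  \<open>n\<close>, and is thus a normal. This works for any prescribed radii, so they can be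
  adapted to a functional that is normal to the smaller set.\<close>

lemma normal_or_negative_gap:
  fixes A :: "'a::real_normed_vector set" and \<rho> :: "nat \<Rightarrow> real"
  assumes \<eta>: "0 \<le> \<eta>" and \<rho>: "\<And>n. 0 < \<rho> n"
    and no: "\<And>b. norm (b - xs) \<le> \<eta> \<Longrightarrow> b \<notin> frechet_normal_cone A u"
  obtains k l n v where "\<And>i. i \<in> {1..k} \<Longrightarrow> 0 \<le> l i \<and> v i \<in> A \<and> dist (v i) u < \<rho> (n i)"
    "sum l {1..k} = 1" "gap xs \<eta> u k l n v < 0"
proof -
  define C where "C = {(v - u, norm (v - u) / (real n + 1) - xs (v - u)) | n v. v \<in> A \<and> dist v u < \<rho> n}"
  have "\<exists>p q. (p, q) \<in> convex hull C \<and> \<eta> * norm p + q < 0"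
  proof (rule ccontr)
    assume "\<not> ?thesis"
    then have "\<And>p q. (p, q) \<in> convex hull C \<Longrightarrow> 0 \<le> \<eta> * norm p + q"
      by (meson not_le)
    then obtain w where w: "norm w \<le> \<eta>" "\<And>p q. (p, q) \<in> C \<Longrightarrow> blinfun_apply w p \<le> q"
      using bounded_functional_exists[OF _ \<eta>] by blast
    have "xs + w \<in> frechet_normal_cone A u"
    proof (rule frechet_normal_coneI, intro exI conjI ballI impI)
      fix n v assume "v \<in> A" "dist v u < \<rho> n"
      then have "w (v - u) \<le> norm (v - u) / (real n + 1) - xs (v - u)"
        by (intro w(2)) (auto simp: C_def)
      then show "(xs + w) (v - u) \<le> norm (v - u) / (real n + 1)"
        by (simp add: blinfun.add_left)
    qed (rule \<rho>)
    then show False using no[of "xs + w"] w(1) by simp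
  qed
  then obtain p q where pq: "(p, q) \<in> convex hull C" "\<eta> * norm p + q < 0" by blast
  then obtain k l z where z: "\<And>i. i \<in> {1..k::nat} \<Longrightarrow> 0 \<le> l i \<and> z i \<in> C" "sum l {1..k} = 1"
      "(\<Sum>i=1..k. l i *\<^sub>R z i) = (p, q)"
    unfolding convex_hull_indexed mem_Collect_eq by metis
  have "\<exists>n v. z i = (v - u, norm (v - u) / (real n + 1) - xs (v - u)) \<and> v \<in> A \<and> dist v u < \<rho> n"
    if "i \<in> {1..k}" for i
    using z(1)[OF that] by (auto simp: C_def)
  then obtain n v where nv: "\<And>i. i \<in> {1..k} \<Longrightarrow>
      z i = (v i - u, norm (v i - u) / (real (n i) + 1) - xs (v i - u)) \<and> v i \<in> A \<and> dist (v i) u < \<rho> (n i)"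
    by metis
  have "p = (\<Sum>i=1..k. l i *\<^sub>R fst (z i))" "q = (\<Sum>i=1..k. l i * snd (z i))"
    using arg_cong[OF z(3), of fst] arg_cong[OF z(3), of snd] by (simp_all add: fst_sum snd_sum)
  moreover have "(\<Sum>i=1..k. l i *\<^sub>R fst (z i)) = (\<Sum>i=1..k. l i *\<^sub>R (v i - u))"
    "(\<Sum>i=1..k. l i * snd (z i)) = (\<Sum>i=1..k. l i * (norm (v i - u) / (real (n i) + 1) - xs (v i - u)))"
    using nv by (intro sum.cong; simp)+
  ultimately have "gap xs \<eta> u k l n v < 0"
    using pq(2) unfolding gap_def by simp
  then show ?thesis using that[of k l v n] z(1,2) nv by blast
qed

text \<open>Suppose \<open>a\<close> is normal to the smaller set at \<open>u\<close> but no normal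
  to \<open>A\<close> is near \<open>xs\<close>. The negative gap at \<open>u\<close> moves to a
  nearby \<open>c\<close> in \<open>C\<close>; the certificate stored for \<open>c\<close> has its
  points in \<open>C\<close>; moved back to \<open>u\<close>, it contradicts the inequalities that
  hold for \<open>a\<close>.\<close>

lemma separable_reduction:
  fixes A :: "'a::real_normed_vector set"
  assumes C0: "countable C0" "C0 \<subseteq> A" and \<eta>: "0 \<le> \<eta>"
  obtains C where "countable C" "C0 \<subseteq> C" "C \<subseteq> A"
    "\<And>u a. u \<in> A \<inter> closure C \<Longrightarrow> norm (a - xs) \<le> \<eta> \<Longrightarrow> a \<in> frechet_normal_cone (A \<inter> closure C) u \<Longrightarrow>
      \<exists>b. norm (b - xs) \<le> \<eta> \<and> b \<in> frechet_normal_cone A u"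
proof -
  \<comment> \<open>\<open>ms\<close> lists reciprocal radii for the finitely many tolerances in
    use, and \<open>j\<close> measures how negative the gap is. Both range over countable types, so
    one stored certificate for each pair adds only countably many points per
    \<open>c\<close>.\<close>
  define wit where "wit = (\<lambda>c (ms :: nat list) (j :: nat) k l n (v :: nat \<Rightarrow> 'a).
    (\<forall>i\<in>{1..k}. 0 \<le> l i \<and> v i \<in> A \<and> n i < length ms \<and> dist (v i) c < 1 / (real (ms ! n i) + 1)) \<and>
    sum l {1..k} = 1 \<and> gap xs \<eta> c k l n v < - 1 / (real j + 1))"
  have "\<exists>V. countable V \<and> V \<subseteq> A \<and> ((\<exists>k l n v. wit c ms j k l n v) \<longrightarrow>
      (\<exists>k l n v. wit c ms j k l n v \<and> v ` {1..k} \<subseteq> V))" for c ms j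
  proof (cases "\<exists>k l n v. wit c ms j k l n v")
    case True
    then obtain k l n v where w: "wit c ms j k l n v" by blast
    then have "v ` {1..k} \<subseteq> A" by (auto simp: wit_def)
    with w show ?thesis by (intro exI[of _ "v ` {1..k}"]) blast
  qed auto
  then obtain V where V: "\<And>c ms j. countable (V c ms j)" "\<And>c ms j. V c ms j \<subseteq> A"
    "\<And>c ms j k l n v. wit c ms j k l n v \<Longrightarrow> \<exists>k l n v. wit c ms j k l n v \<and> v ` {1..k} \<subseteq> V c ms j"
    by metis
  define G where "G = (\<lambda>c. \<Union>ms. \<Union>j. V c ms j)"
  have "countable (G c)" for c using V(1) by (auto simp: G_def)
  then obtain C where C: "countable C" "C0 \<subseteq> C" "C \<subseteq> C0 \<union> (\<Union>c. G c)" "\<And>c. c \<in> C \<Longrightarrow> G c \<subseteq> C"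
    using countable_closure_under[OF C0(1)] by metis
  have CA: "C \<subseteq> A" using C(3) C0(2) V(2) by (fastforce simp: G_def)
  show ?thesis
  proof (rule that[OF C(1,2) CA], rule ccontr)
    fix u a
    assume u: "u \<in> A \<inter> closure C" and a: "norm (a - xs) \<le> \<eta>" "a \<in> frechet_normal_cone (A \<inter> closure C) u"
      and "\<not> (\<exists>b. norm (b - xs) \<le> \<eta> \<and> b \<in> frechet_normal_cone A u)"
    then have no: "\<And>b. norm (b - xs) \<le> \<eta> \<Longrightarrow> b \<notin> frechet_normal_cone A u" by blast
    have "\<exists>m::nat. \<forall>v\<in>A \<inter> closure C. dist v u < 1 / (real m + 1) \<longrightarrow> a (v - u) \<le> norm (v - u) / (real n + 1)" for n :: nat
    proof -
      obtain \<delta> where \<delta>: "0 < \<delta>"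
        "\<And>v. v \<in> A \<inter> closure C \<Longrightarrow> dist v u < \<delta> \<Longrightarrow> a (v - u) \<le> (1 / (real n + 1)) * norm (v - u)"
        using frechet_normal_coneD[OF a(2), of "1 / (real n + 1)"] by auto
      obtain m where "1 / (real m + 1) < \<delta>"
        using reals_Archimedean[OF \<delta>(1)] by (auto simp: inverse_eq_divide add.commute)
      then show ?thesis using \<delta>(2) by (intro exI[of _ m]) force
    qed
    then obtain \<sigma> :: "nat \<Rightarrow> nat" where \<sigma>:
      "\<And>n v. v \<in> A \<inter> closure C \<Longrightarrow> dist v u < 1 / (real (\<sigma> n) + 1) \<Longrightarrow> a (v - u) \<le> norm (v - u) / (real n + 1)"
      by metis
    \<comment> \<open>Three nested radii with denominators \<sigma> + 3, \<sigma> + 2 and \<sigma> +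
      1 leave room for two moves: from \<open>u\<close> to \<open>c\<close>, where \<open>ms\<close>
      holds \<open>\<sigma> n + 1\<close> and \<open>wit\<close> adds one more, and back to
      \<open>u\<close>.\<close>
    obtain k l n v where w: "\<And>i. i \<in> {1..k} \<Longrightarrow> 0 \<le> l i \<and> v i \<in> A \<and> dist (v i) u < 1 / (real (\<sigma> (n i)) + 3)"
      "sum l {1..k} = 1" "gap xs \<eta> u k l n v < 0"
      using normal_or_negative_gap[OF \<eta> _ no, of "\<lambda>n. 1 / (real (\<sigma> n) + 3)"] by (smt (verit) of_nat_0_le_iff zero_less_divide_1_iff)
    \<comment> \<open>The gap lies below \<open>- 2 / (j + 1)\<close>. Each of the two moves costs
      at most \<open>1 / (j + 1)\<close>, so the final gap is still negative.\<close>
    obtain j where j: "1 / (real j + 1) < - gap xs \<eta> u k l n v / 2"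
      using reals_Archimedean[of "- gap xs \<eta> u k l n v / 2"] w(3) by (auto simp: inverse_eq_divide add.commute)
    define N where "N = Suc (Max (insert 0 (n ` {1..k})))"
    have nN: "n i < N" if "i \<in> {1..k}" for i
      using that by (auto simp: N_def less_Suc_eq_le intro!: Max_ge)
    define ms where "ms = map (\<lambda>n. \<sigma> n + 1) [0..<N]"
    have ms: "length ms = N" "\<And>n. n < N \<Longrightarrow> ms ! n = \<sigma> n + 1" by (auto simp: ms_def)
    have pos: "1 / (real m + 2) < 1 / (real m + 1)" "1 / (real m + 3) < 1 / (real m + 2)" for m :: nat
      by (auto simp: field_simps)
    obtain d1 where d1: "0 < d1" "\<And>n. n < N \<Longrightarrow> d1 \<le> 1 / (real (\<sigma> n) + 1) - 1 / (real (\<sigma> n) + 2)"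
      using positive_lower_bound[of N "\<lambda>n. 1 / (real (\<sigma> n) + 1) - 1 / (real (\<sigma> n) + 2)"] pos by auto
    obtain d2 where d2: "0 < d2" "\<And>n. n < N \<Longrightarrow> d2 \<le> 1 / (real (\<sigma> n) + 2) - 1 / (real (\<sigma> n) + 3)"
      using positive_lower_bound[of N "\<lambda>n. 1 / (real (\<sigma> n) + 2) - 1 / (real (\<sigma> n) + 3)"] pos by auto
    define M where "M = 1 + norm xs + \<eta>"
    have M: "M > 0" using \<eta> by (simp add: M_def add_pos_nonneg)
    define d where "d = min (min d1 d2) (1 / (real j + 1) / M)"
    have "d > 0" using d1 d2 M by (simp add: d_def)
    then obtain c where c: "c \<in> C" "dist c u < d"
      using u by (auto simp: closure_approachable)
    have "M * dist c u \<le> M * (1 / (real j + 1) / M)"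
      using c(2) M by (intro mult_left_mono) (auto simp: d_def)
    then have Mc: "M * dist c u \<le> 1 / (real j + 1)" using M by simp
    have "wit c ms j k l n v"
      unfolding wit_def
    proof (intro conjI ballI)
      fix i assume i: "i \<in> {1..k}"
      have "dist (v i) c \<le> dist (v i) u + dist c u"
        by (metis dist_commute dist_triangle)
      then have "dist (v i) c < 1 / (real (\<sigma> (n i)) + 2)"
        using w(1)[OF i] c(2) d2(2)[OF nN[OF i]] by (simp add: d_def)
      then show "dist (v i) c < 1 / (real (ms ! n i) + 1)"
        using ms(2)[OF nN[OF i]] by (simp add: add.commute)
      show "n i < length ms" using nN[OF i] ms by simp
    next
      show "gap xs \<eta> c k l n v < - 1 / (real j + 1)"
        using gap_lipschitz[of k l \<eta> xs c n v u] w \<eta> Mc j by (simp add: M_def)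
    qed (use w in auto)
    \<comment> \<open>The stored certificate may be unrelated to the one that was moved. It shares
      only \<open>c\<close>, \<open>ms\<close> and \<open>j\<close>; the clause
      \<open>n i < length ms\<close> ensures that its radii are among those for which
      \<open>d1\<close> was chosen.\<close>
    then obtain k' l' n' v' where w': "wit c ms j k' l' n' v'" "v' ` {1..k'} \<subseteq> V c ms j"
      using V(3) by blast
    have v'C: "v' i \<in> A \<inter> closure C" if "i \<in> {1..k'}" for i
    proof -
      have "v' i \<in> G c" using w'(2) that unfolding G_def by blast
      then show ?thesis using C(4)[OF c(1)] CA closure_subset[of C] by blast
    qed
    have "0 \<le> gap xs \<eta> u k' l' n' v'"
    proof (rule gap_nonneg[OF _ a(1)])
      fix i assume i: "i \<in> {1..k'}"
      then show "0 \<le> l' i" using w'(1) by (auto simp: wit_def)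
      have ni: "n' i < N" "dist (v' i) c < 1 / (real (ms ! n' i) + 1)"
        using w'(1)[unfolded wit_def ms(1), THEN conjunct1, THEN bspec, OF i] by blast+
      have "dist (v' i) u \<le> dist (v' i) c + dist c u"
        by (rule dist_triangle)
      then have "dist (v' i) u < 1 / (real (\<sigma> (n' i)) + 1)"
        using ni ms(2)[OF ni(1)] c(2) d1(2)[OF ni(1)] by (simp add: d_def add.commute)
      then show "a (v' i - u) \<le> norm (v' i - u) / (real (n' i) + 1)"
        using \<sigma> v'C[OF i] by blast
    qed
    moreover have "gap xs \<eta> u k' l' n' v' \<le> gap xs \<eta> c k' l' n' v' + M * dist u c"
      unfolding M_def using w'(1) by (intro gap_lipschitz \<eta>) (auto simp: wit_def)
    moreover have "gap xs \<eta> c k' l' n' v' < - 1 / (real j + 1)"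
      using w'(1) by (simp add: wit_def)
    ultimately show False using Mc by (simp add: dist_commute)
  qed
qed

section \<open>Separability of the dual ball in an Asplund space\<close>

text \<open>The convex function showing that an uncountable separated family cannot exist is the
  supremum of its members up to countably many exceptions: discarding countably many members makes
  every slice uncountable, hence of large diameter, so this function is nowhere Frechet
  differentiable.\<close>

definition ess_sup :: "('a::real_normed_vector \<Rightarrow>\<^sub>L real) set \<Rightarrow> 'a \<Rightarrow> real" where
  "ess_sup F x = Inf {c. countable {a \<in> F. c < blinfun_apply a x}}"

context
  fixes F :: "('a::real_normed_vector \<Rightarrow>\<^sub>L real) set"
  assumes F: "uncountable F" "\<And>a. a \<in> F \<Longrightarrow> norm a \<le> 1"
begin

private lemma apply_le: "a \<in> F \<Longrightarrow> \<bar>blinfun_apply a x\<bar> \<le> norm x"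
  using norm_blinfun[of a x] F(2)[of a] mult_right_mono[of "norm a" 1 "norm x"] by simp

text \<open>Uncountability of \<open>F\<close> excludes very negative \<open>c\<close>: below
  \<open>- norm x\<close>, every member of \<open>F\<close> exceeds \<open>c\<close>.\<close>

private lemma ess_sup_bdd: "bdd_below {c. countable {a \<in> F. c < blinfun_apply a x}}"
proof (rule bdd_belowI[of _ "- norm x - 1"], rule ccontr)
  fix c assume "c \<in> {c. countable {a \<in> F. c < blinfun_apply a x}}" and c: "\<not> - norm x - 1 \<le> c"
  moreover have "{a \<in> F. c < blinfun_apply a x} = F"
    using apply_le[of _ x] c by force
  ultimately show False using F(1) by simp
qed

private lemma ess_sup_le: "countable {a \<in> F. c < blinfun_apply a x} \<Longrightarrow> ess_sup F x \<le> c"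
  unfolding ess_sup_def by (rule cInf_lower[OF _ ess_sup_bdd]) simp

private lemma ess_sup_le_norm: "ess_sup F x \<le> norm x"
proof (rule ess_sup_le)
  have "{a \<in> F. norm x < blinfun_apply a x} = {}"
    using apply_le[of _ x] by force
  then show "countable {a \<in> F. norm x < blinfun_apply a x}" by (metis countable_empty)
qed

text \<open>The infimum is attained, because countably many countable exceptional sets have a
  countable union.\<close>

private lemma countable_above_ess_sup: "countable {a \<in> F. ess_sup F x < blinfun_apply a x}"
proof -
  have "countable {a \<in> F. ess_sup F x + 1 / (real n + 1) < blinfun_apply a x}" for n
  proof -
    have "{c. countable {a \<in> F. c < blinfun_apply a x}} \<noteq> {}"
    proof -
      have "{a \<in> F. norm x < blinfun_apply a x} = {}"
        using apply_le[of _ x] by force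
      then show ?thesis by (metis (mono_tags, lifting) countable_empty empty_Collect_eq)
    qed
    then obtain c where c: "countable {a \<in> F. c < blinfun_apply a x}" "c < ess_sup F x + 1 / (real n + 1)"
      using cInf_lessD[of "{c. countable {a \<in> F. c < blinfun_apply a x}}" "ess_sup F x + 1 / (real n + 1)"]
      by (auto simp: ess_sup_def)
    show ?thesis by (rule countable_subset[OF _ c(1)]) (use c(2) in auto)
  qed
  moreover have "{a \<in> F. ess_sup F x < blinfun_apply a x} =
      (\<Union>n. {a \<in> F. ess_sup F x + 1 / (real n + 1) < blinfun_apply a x})"
  proof safe
    fix a assume a: "a \<in> F" "ess_sup F x < blinfun_apply a x"
    then obtain n where "1 / (real n + 1) < blinfun_apply a x - ess_sup F x"
      using reals_Archimedean[of "blinfun_apply a x - ess_sup F x"] by (auto simp: inverse_eq_divide add.commute)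
    then show "a \<in> (\<Union>n. {a \<in> F. ess_sup F x + 1 / (real n + 1) < blinfun_apply a x})"
      using a by (auto simp: algebra_simps)
  next
    fix a n assume *: "ess_sup F x + 1 / (real n + 1) < blinfun_apply a x"
    have "0 < 1 / (real n + 1)" by simp
    then show "ess_sup F x < blinfun_apply a x" using * by linarith
  qed
  ultimately show ?thesis by simp
qed

private lemma uncountable_below_ess_sup:
  assumes "c < ess_sup F x"
  shows "uncountable {a \<in> F. c < blinfun_apply a x}"
  using ess_sup_le[of c x] assms by linarith

text \<open>Outside the union of the exceptional sets of \<open>x\<close> and \<open>y\<close>,
  which is countable, the two bounds add up.\<close>

private lemma sublinear_ess_sup: "sublinear (ess_sup F)"
  unfolding sublinear_def
proof safe
  fix x y
  have "countable ({a \<in> F. ess_sup F x < blinfun_apply a x} \<union> {a \<in> F. ess_sup F y < blinfun_apply a y})"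
    using countable_above_ess_sup by simp
  then have "countable {a \<in> F. ess_sup F x + ess_sup F y < blinfun_apply a (x + y)}"
    by (rule countable_subset[rotated]) (auto simp: blinfun.add_right)
  then show "ess_sup F (x + y) \<le> ess_sup F x + ess_sup F y"
    by (rule ess_sup_le)
next
  fix t :: real and x :: 'a assume "0 \<le> t"
  then have "{a \<in> F. t * ess_sup F x < blinfun_apply a (t *\<^sub>R x)} \<subseteq> {a \<in> F. ess_sup F x < blinfun_apply a x}"
    by (auto simp: blinfun.scaleR_right mult_less_cancel_left)
  then show "ess_sup F (t *\<^sub>R x) \<le> t * ess_sup F x"
    by (intro ess_sup_le countable_subset[OF _ countable_above_ess_sup])
qed

private lemma ess_sup_convex: "convex_on UNIV (ess_sup F)"
proof (rule convex_onI)
  fix t :: real and x y :: 'a assume "0 < t" "t < 1"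
  then show "ess_sup F ((1 - t) *\<^sub>R x + t *\<^sub>R y) \<le> (1 - t) * ess_sup F x + t * ess_sup F y"
    using sublinearD(1)[OF sublinear_ess_sup, of "(1 - t) *\<^sub>R x" "t *\<^sub>R y"]
      sublinearD(2)[OF sublinear_ess_sup, of "1 - t" x] sublinearD(2)[OF sublinear_ess_sup, of t y]
    by simp
qed simp

private lemma ess_sup_continuous: "continuous_on UNIV (ess_sup F)"
proof -
  have "ess_sup F x - ess_sup F y \<le> dist x y" for x y
    using sublinearD(1)[OF sublinear_ess_sup, of y "x - y"] ess_sup_le_norm[of "x - y"]
    by (simp add: dist_norm)
  then have "dist (ess_sup F x) (ess_sup F y) \<le> 1 * dist x y" for x y
    by (metis abs_diff_le_iff abs_le_iff dist_commute dist_real_def minus_diff_eq mult_1)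
  then have "1-lipschitz_on UNIV (ess_sup F)"
    by (intro lipschitz_onI) auto
  then show ?thesis by (rule lipschitz_on_continuous_on)
qed

text \<open>A derivative at \<open>z\<close> would pin down, uniformly over \<open>E\<close>, all
  but countably many of the members that are nearly maximal at \<open>z\<close>. Uncountably many of
  them remain, so two would be too close to be separated.\<close>

lemma ess_sup_not_differentiable:
  assumes E: "countable E" "\<And>y. y \<in> E \<Longrightarrow> norm y \<le> 1"
    and e: "0 < e" "\<And>a b. a \<in> F \<Longrightarrow> b \<in> F \<Longrightarrow> a \<noteq> b \<Longrightarrow> \<exists>y\<in>E. e < \<bar>blinfun_apply a y - blinfun_apply b y\<bar>"
  shows "\<not> ess_sup F differentiable (at z)"
proof
  let ?p = "ess_sup F"
  assume "?p differentiable (at z)"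
  then obtain D where D: "(?p has_derivative D) (at z)" by (auto simp: differentiable_def)
  then have lin: "linear D" by (simp add: has_derivative_linear)
  obtain d where d: "0 < d" "\<And>x. norm (x - z) < d \<Longrightarrow> norm (?p x - ?p z - D (x - z)) \<le> e / 8 * norm (x - z)"
    using D[unfolded has_derivative_at_alt] e(1) by (meson divide_pos_pos zero_less_numeral)
  define t where "t = d / 2"
  have t: "0 < t" "t < d" using d by (auto simp: t_def)
  define bad where "bad = (\<Union>y\<in>E. {a \<in> F. ?p (z + t *\<^sub>R y) < blinfun_apply a (z + t *\<^sub>R y)} \<union>
    {a \<in> F. ?p (z + t *\<^sub>R (- y)) < blinfun_apply a (z + t *\<^sub>R (- y))})"
  \<comment> \<open>Discarded are the members that exceed the essential supremum at some
    \<open>z + t y\<close> or \<open>z - t y\<close>. Countability of \<open>E\<close> makes them a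
    countable set, whereas the slice just below the value at \<open>z\<close> is
    uncountable.\<close>
  define S where "S = {a \<in> F. ?p z - t * e / 8 < blinfun_apply a z} - bad"
  have "countable bad"
    unfolding bad_def using E(1) countable_above_ess_sup by (intro countable_UN countable_Un) auto
  moreover have "uncountable {a \<in> F. ?p z - t * e / 8 < blinfun_apply a z}"
    using t e(1) by (intro uncountable_below_ess_sup) simp
  ultimately have "uncountable S"
    unfolding S_def by (rule uncountable_minus_countable[rotated])
  have close: "\<bar>blinfun_apply a y - D y\<bar> \<le> e / 4" if a: "a \<in> S" and y: "y \<in> E" for a y
  proof -
    \<comment> \<open>One \<open>e / 8\<close> comes from the remainder of the derivative and one
      from the slack of the slice, both scaled by \<open>t\<close>.\<close>
    have *: "blinfun_apply a w - D w \<le> e / 4" if w: "norm w \<le> 1" "blinfun_apply a (z + t *\<^sub>R w) \<le> ?p (z + t *\<^sub>R w)" for w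
    proof -
      have nt: "norm (t *\<^sub>R w) \<le> t"
        using w(1) t mult_left_mono[of "norm w" 1 t] by simp
      have "norm (?p (z + t *\<^sub>R w) - ?p z - D (t *\<^sub>R w)) \<le> e / 8 * norm (t *\<^sub>R w)"
        using d(2)[of "z + t *\<^sub>R w"] nt t by (simp del: norm_scaleR)
      then have "?p (z + t *\<^sub>R w) - ?p z - D (t *\<^sub>R w) \<le> e / 8 * norm (t *\<^sub>R w)"
        by (rule order_trans[rotated]) simp
      also have "\<dots> \<le> e / 8 * t"
        using nt e(1) by (intro mult_left_mono) auto
      finally have "blinfun_apply a z + t * blinfun_apply a w \<le> ?p z + t * D w + e / 8 * t"
        using w(2) linear_cmul[OF lin, of t w] by (simp add: blinfun.add_right blinfun.scaleR_right)
      moreover have "?p z - t * e / 8 < blinfun_apply a z" using a by (simp add: S_def)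
      ultimately have "t * (blinfun_apply a w - D w) \<le> t * (e / 4)"
        by (simp add: algebra_simps)
      then show ?thesis using t(1) by simp
    qed
    have "blinfun_apply a (z + t *\<^sub>R y) \<le> ?p (z + t *\<^sub>R y)" "blinfun_apply a (z + t *\<^sub>R (- y)) \<le> ?p (z + t *\<^sub>R (- y))"
      using a y by (force simp: S_def bad_def)+
    then have "blinfun_apply a y - D y \<le> e / 4" "blinfun_apply a (- y) - D (- y) \<le> e / 4"
      using E(2)[OF y] *[of y] *[of "- y"] by simp_all
    then show ?thesis
      unfolding abs_le_iff using linear_neg[OF lin, of y] by (simp add: blinfun.minus_right)
  qed
  obtain a where a: "a \<in> S" using \<open>uncountable S\<close> by (metis countable_empty ex_in_conv)
  have "uncountable (S - {a})" using \<open>uncountable S\<close> by (simp add: uncountable_minus_countable)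
  then obtain b where b: "b \<in> S" "b \<noteq> a" by (metis Diff_iff countable_empty ex_in_conv insertCI)
  then obtain y where "y \<in> E" "e < \<bar>blinfun_apply a y - blinfun_apply b y\<bar>"
    using e(2)[of a b] a by (auto simp: S_def)
  then show False using close[OF a, of y] close[OF b(1), of y] e(1) by linarith
qed

lemma separated_not_asplund:
  assumes "countable E" "\<And>y. y \<in> E \<Longrightarrow> norm y \<le> 1"
    and "0 < e" "\<And>a b. a \<in> F \<Longrightarrow> b \<in> F \<Longrightarrow> a \<noteq> b \<Longrightarrow> \<exists>y\<in>E. e < \<bar>blinfun_apply a y - blinfun_apply b y\<bar>"
  shows "\<exists>f :: 'a \<Rightarrow> real. convex_on UNIV f \<and> continuous_on UNIV f \<and> (\<forall>z. \<not> f differentiable (at z))"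
  using ess_sup_convex ess_sup_continuous ess_sup_not_differentiable[OF assms] by blast

end

text \<open>A point related to all members of a maximal family could be adjoined to it; symmetry
  gives the relation in both orders. Taking \<open>R\<close> as being more than \<open>e\<close>
  apart turns a maximal family into an \<open>e\<close>-net.\<close>

lemma maximal_separated_subset:
  fixes R :: "'a \<Rightarrow> 'a \<Rightarrow> bool"
  assumes sym: "\<And>a b. R a b \<Longrightarrow> R b a"
  obtains F where "F \<subseteq> B" "\<And>a b. a \<in> F \<Longrightarrow> b \<in> F \<Longrightarrow> a \<noteq> b \<Longrightarrow> R a b"
    "\<And>b. b \<in> B \<Longrightarrow> \<exists>a\<in>F. a = b \<or> \<not> R a b"
proof -
  define S where "S = {F. F \<subseteq> B \<and> (\<forall>a\<in>F. \<forall>b\<in>F. a \<noteq> b \<longrightarrow> R a b)}"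
  have "\<exists>M\<in>S. \<forall>X\<in>S. M \<subseteq> X \<longrightarrow> X = M"
  proof (rule subset_Zorn')
    fix C assume C: "subset.chain S C"
    then have CS: "C \<subseteq> S" and ch: "\<And>X Y. X \<in> C \<Longrightarrow> Y \<in> C \<Longrightarrow> X \<subseteq> Y \<or> Y \<subseteq> X"
      by (auto simp: subset_chain_def)
    have "R a b" if ab: "X \<in> C" "a \<in> X" "Y \<in> C" "b \<in> Y" "a \<noteq> b" for X Y a b
      using ch[OF ab(1,3)] ab CS unfolding S_def by blast
    moreover have "\<Union>C \<subseteq> B" using CS by (auto simp: S_def)
    ultimately show "\<Union>C \<in> S" unfolding S_def by blast
  qed
  then obtain M where M: "M \<in> S" "\<And>X. X \<in> S \<Longrightarrow> M \<subseteq> X \<Longrightarrow> X = M" by blast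
  show ?thesis
  proof (rule that[of M])
    fix b assume b: "b \<in> B"
    show "\<exists>a\<in>M. a = b \<or> \<not> R a b"
    proof (rule ccontr)
      assume n: "\<not> ?thesis"
      then have "insert b M \<in> S" using M(1) b sym by (auto simp: S_def)
      then have "insert b M = M" using M(2)[of "insert b M"] by blast
      then show False using n by blast
    qed
  qed (use M(1) in \<open>auto simp: S_def\<close>)
qed

text \<open>The Asplund property makes a maximal separated family countable at every scale, and the
  nets for the scales \<open>1 / (n + 1)\<close> together form the sequence. Closeness is uniform
  over \<open>E\<close>, which is stronger than pointwise closeness.\<close>

lemma asplund_dual_ball_separable:
  fixes E :: "'a::banach set"
  assumes asp: "asplund_space TYPE('a)" and E: "countable E" "\<And>y. y \<in> E \<Longrightarrow> norm y \<le> 1"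
  obtains d :: "nat \<Rightarrow> ('a \<Rightarrow>\<^sub>L real)" where "\<And>k. norm (d k) \<le> 1"
    "\<And>b e. norm b \<le> 1 \<Longrightarrow> 0 < e \<Longrightarrow> \<exists>k. \<forall>y\<in>E. \<bar>blinfun_apply b y - blinfun_apply (d k) y\<bar> \<le> e"
proof -
  have "\<exists>F :: ('a \<Rightarrow>\<^sub>L real) set. countable F \<and> F \<subseteq> {a. norm a \<le> 1} \<and>
      (\<forall>b. norm b \<le> 1 \<longrightarrow> (\<exists>a\<in>F. \<forall>y\<in>E. \<bar>blinfun_apply b y - blinfun_apply a y\<bar> \<le> e))"
    if e: "0 < e" for e
  proof -
    define R where "R = (\<lambda>a b :: 'a \<Rightarrow>\<^sub>L real. \<exists>y\<in>E. e < \<bar>blinfun_apply a y - blinfun_apply b y\<bar>)"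
    obtain F where F: "F \<subseteq> {a. norm a \<le> 1}" "\<And>a b. a \<in> F \<Longrightarrow> b \<in> F \<Longrightarrow> a \<noteq> b \<Longrightarrow> R a b"
      "\<And>b. b \<in> {a. norm a \<le> 1} \<Longrightarrow> \<exists>a\<in>F. a = b \<or> \<not> R a b"
    proof (rule maximal_separated_subset[of R "{a. norm a \<le> 1}"])
      show "R b a" if "R a b" for a b
        using that unfolding R_def by (simp add: abs_minus_commute)
    qed blast
    have "countable F"
    proof (rule ccontr)
      assume "uncountable F"
      then have "\<exists>f :: 'a \<Rightarrow> real. convex_on UNIV f \<and> continuous_on UNIV f \<and> (\<forall>z. \<not> f differentiable (at z))"
        by (rule separated_not_asplund[OF _ _ E e]) (use F(1,2) in \<open>auto simp: R_def\<close>)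
      then obtain f :: "'a \<Rightarrow> real" where f: "convex_on UNIV f" "continuous_on UNIV f" "\<And>z. \<not> f differentiable (at z)"
        by blast
      then have "UNIV \<subseteq> closure {x \<in> UNIV. f differentiable (at x)}"
        using asp[unfolded asplund_space_def, rule_format, of UNIV f] by simp
      then show False using f(3) by simp
    qed
    moreover have "\<exists>a\<in>F. \<forall>y\<in>E. \<bar>blinfun_apply b y - blinfun_apply a y\<bar> \<le> e" if nb: "norm b \<le> 1" for b
    proof -
      obtain a where a: "a \<in> F" "a = b \<or> \<not> R a b" using F(3)[of b] nb by blast
      then have "\<bar>blinfun_apply b y - blinfun_apply a y\<bar> \<le> e" if "y \<in> E" for y
        using a(2) that e unfolding R_def by (auto simp: not_less abs_minus_commute)
      then show ?thesis using a(1) by blast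
    qed
    ultimately show ?thesis using F(1) by blast
  qed
  then have "\<exists>F :: ('a \<Rightarrow>\<^sub>L real) set. countable F \<and> F \<subseteq> {a. norm a \<le> 1} \<and>
      (\<forall>b. norm b \<le> 1 \<longrightarrow> (\<exists>a\<in>F. \<forall>y\<in>E. \<bar>blinfun_apply b y - blinfun_apply a y\<bar> \<le> 1 / (real n + 1)))" for n :: nat
    by simp
  then obtain F where F: "\<And>n::nat. countable (F n)" "\<And>n. F n \<subseteq> {a. norm a \<le> 1}"
    "\<And>n b. norm b \<le> 1 \<Longrightarrow> \<exists>a\<in>F n. \<forall>y\<in>E. \<bar>blinfun_apply b y - blinfun_apply a y\<bar> \<le> 1 / (real n + 1)"
    by metis
  define U where "U = (\<Union>n. F n)"
  have "F 0 \<noteq> {}" using F(3)[of 0 0] by auto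
  then have U: "countable U" "U \<noteq> {}" using F(1) by (auto simp: U_def)
  show ?thesis
  proof (rule that[of "from_nat_into U"])
    show "norm (from_nat_into U k) \<le> 1" for k
      using from_nat_into[OF U(2), of k] F(2) by (auto simp: U_def)
    fix b :: "'a \<Rightarrow>\<^sub>L real" and e :: real assume b: "norm b \<le> 1" and e: "0 < e"
    obtain n where n: "1 / (real n + 1) < e"
      using reals_Archimedean[OF e] by (auto simp: inverse_eq_divide add.commute)
    obtain a where a: "a \<in> F n" "\<forall>y\<in>E. \<bar>blinfun_apply b y - blinfun_apply a y\<bar> \<le> 1 / (real n + 1)"
      using F(3)[OF b] by blast
    then obtain k where "from_nat_into U k = a"
      using from_nat_into_surj[OF U(1), of a] by (auto simp: U_def)
    then show "\<exists>k. \<forall>y\<in>E. \<bar>blinfun_apply b y - blinfun_apply (from_nat_into U k) y\<bar> \<le> e"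
      using a(2) n by (intro exI[of _ k]) force
  qed
qed

section \<open>Smooth approximations of the norm\<close>

text \<open>Banach-Alaoglu: plain functions carry the topology of pointwise convergence, in which
  the linear ones form a closed part of a Tychonoff product of intervals.\<close>

lemma compact_dual_ball:
  "compact (blinfun_apply ` {a :: 'a::real_normed_vector \<Rightarrow>\<^sub>L real. norm a \<le> 1})"
proof -
  have "compactin (product_topology (\<lambda>x::'a. euclidean) UNIV) (PiE UNIV (\<lambda>x. {- norm x..norm x}))"
    unfolding compactin_PiE by simp
  then have "compact (PiE UNIV (\<lambda>x::'a. {- norm x..norm x}))"
    by (simp add: euclidean_product_topology)
  moreover have "closed ((\<Inter>x. \<Inter>y. {f :: 'a \<Rightarrow> real. f (x + y) = f x + f y}) \<inter> (\<Inter>t. \<Inter>x. {f. f (t *\<^sub>R x) = t * f x}))"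
    by (intro closed_Int closed_INT ballI closed_Collect_eq continuous_intros continuous_on_product_coordinates)
  ultimately have "compact (PiE UNIV (\<lambda>x::'a. {- norm x..norm x}) \<inter>
      ((\<Inter>x. \<Inter>y. {f :: 'a \<Rightarrow> real. f (x + y) = f x + f y}) \<inter> (\<Inter>t. \<Inter>x. {f. f (t *\<^sub>R x) = t * f x})))"
    by (rule compact_Int_closed)
  also have "\<dots> = blinfun_apply ` {a :: 'a \<Rightarrow>\<^sub>L real. norm a \<le> 1}"
  proof (intro equalityI subsetI)
    fix f assume f: "f \<in> PiE UNIV (\<lambda>x::'a. {- norm x..norm x}) \<inter>
      ((\<Inter>x. \<Inter>y. {f :: 'a \<Rightarrow> real. f (x + y) = f x + f y}) \<inter> (\<Inter>t. \<Inter>x. {f. f (t *\<^sub>R x) = t * f x}))"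
    have b: "\<bar>f x\<bar> \<le> norm x" for x
    proof -
      have "f x \<in> {- norm x..norm x}" using f by blast
      then show ?thesis by (simp add: abs_le_iff minus_le_iff)
    qed
    have "bounded_linear f"
      using f b by (intro bounded_linear_intro[of _ 1]) auto
    then show "f \<in> blinfun_apply ` {a. norm a \<le> 1}"
      using b by (intro image_eqI[of _ _ "Blinfun f"])
        (auto simp: bounded_linear_Blinfun_apply intro!: norm_blinfun_bound)
  next
    fix f assume "f \<in> blinfun_apply ` {a :: 'a \<Rightarrow>\<^sub>L real. norm a \<le> 1}"
    then obtain a :: "'a \<Rightarrow>\<^sub>L real" where a: "norm a \<le> 1" "f = blinfun_apply a" by auto
    have "\<bar>blinfun_apply a x\<bar> \<le> norm x" for x
      using norm_blinfun[of a x] mult_right_mono[OF a(1), of "norm x"] by simp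
    then show "f \<in> PiE UNIV (\<lambda>x::'a. {- norm x..norm x}) \<inter>
      ((\<Inter>x. \<Inter>y. {f :: 'a \<Rightarrow> real. f (x + y) = f x + f y}) \<inter> (\<Inter>t. \<Inter>x. {f. f (t *\<^sub>R x) = t * f x}))"
      by (auto simp: a(2) blinfun.add_right blinfun.scaleR_right abs_le_iff minus_le_iff)
  qed
  finally show ?thesis .
qed

text \<open>The closed sets \<open>K t\<close> live among all functions and cut out the superlevel
  sets of \<Psi> on the ball; this expresses weak* upper semicontinuity without a topology on the
  type of functionals. Compactness then gives a common point of the superlevel sets just below the
  supremum.\<close>

lemma dual_ball_attains_sup:
  fixes \<Psi> :: "('a::real_normed_vector \<Rightarrow>\<^sub>L real) \<Rightarrow> real"
  assumes cl: "\<And>t. closed (K t)" "\<And>t a. norm a \<le> 1 \<Longrightarrow> blinfun_apply a \<in> K t \<longleftrightarrow> t \<le> \<Psi> a"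
    and bdd: "bdd_above (\<Psi> ` {a. norm a \<le> 1})"
  obtains a where "norm a \<le> 1" "\<And>b. norm b \<le> 1 \<Longrightarrow> \<Psi> b \<le> \<Psi> a"
proof -
  let ?B = "{a :: 'a \<Rightarrow>\<^sub>L real. norm a \<le> 1}"
  define m where "m = (SUP a\<in>?B. \<Psi> a)"
  have ne: "?B \<noteq> {}" by (auto intro: exI[of _ 0])
  have "blinfun_apply ` ?B \<inter> (\<Inter>n\<in>UNIV. K (m - 1 / (real n + 1))) \<noteq> {}"
  proof (rule compact_imp_fip_image[OF compact_dual_ball cl(1)])
    fix I :: "nat set" assume I: "finite I"
    define N where "N = Max (insert 0 I)"
    have "m - 1 / (real N + 1) < m" by simp
    then obtain a where a: "norm a \<le> 1" "m - 1 / (real N + 1) < \<Psi> a"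
      unfolding m_def less_cSUP_iff[OF ne bdd] by blast
    have "blinfun_apply a \<in> K (m - 1 / (real n + 1))" if "n \<in> I" for n
    proof -
      have "n \<le> N" using I that by (simp add: N_def)
      then have "1 / (real N + 1) \<le> 1 / (real n + 1)" by (simp add: frac_le)
      then show ?thesis using cl(2)[OF a(1)] a(2) by simp
    qed
    then show "blinfun_apply ` ?B \<inter> (\<Inter>n\<in>I. K (m - 1 / (real n + 1))) \<noteq> {}"
      using a(1) by blast
  qed
  then obtain a where a: "norm a \<le> 1" "\<And>n::nat. blinfun_apply a \<in> K (m - 1 / (real n + 1))"
    by blast
  have le: "m \<le> \<Psi> a + 1 / (real n + 1)" for n :: nat
    using a(2)[of n] cl(2)[OF a(1)] by (simp add: algebra_simps)
  have "m \<le> \<Psi> a"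
  proof (rule field_le_epsilon)
    fix e :: real assume "0 < e"
    then obtain n where "1 / (real n + 1) < e"
      using reals_Archimedean[of e] by (auto simp: inverse_eq_divide add.commute)
    then show "m \<le> \<Psi> a + e" using le[of n] by linarith
  qed
  then show ?thesis
    using that[OF a(1)] cSUP_upper[OF _ bdd] by (force simp: m_def)
qed

text \<open>If \<open>E\<close> consists of the normalized differences of the points of a set, this
  is the Lipschitz constant of \<open>b\<close> on that set.\<close>

definition dual_seminorm :: "'a set \<Rightarrow> ('a::real_normed_vector \<Rightarrow>\<^sub>L real) \<Rightarrow> real" where
  "dual_seminorm E b = (SUP y\<in>E. \<bar>blinfun_apply b y\<bar>)"

context
  fixes E :: "'a::real_normed_vector set"
  assumes E: "E \<noteq> {}" "\<And>y. y \<in> E \<Longrightarrow> norm y \<le> 1"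
begin

lemma dual_seminorm_bdd: "bdd_above ((\<lambda>y. \<bar>blinfun_apply b y\<bar>) ` E)"
  and dual_seminorm_le_norm: "dual_seminorm E b \<le> norm b"
proof -
  have *: "\<bar>blinfun_apply b y\<bar> \<le> norm b" if "y \<in> E" for y
    using norm_blinfun[of b y] mult_left_mono[OF E(2)[OF that], of "norm b"] by simp
  show "bdd_above ((\<lambda>y. \<bar>blinfun_apply b y\<bar>) ` E)"
    using * by (intro bdd_aboveI2)
  show "dual_seminorm E b \<le> norm b"
    unfolding dual_seminorm_def using * E(1) by (intro cSUP_least)
qed

lemma apply_le_dual_seminorm: "y \<in> E \<Longrightarrow> \<bar>blinfun_apply b y\<bar> \<le> dual_seminorm E b"
  unfolding dual_seminorm_def by (rule cSUP_upper[OF _ dual_seminorm_bdd])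

lemma dual_seminorm_least:
  "(\<And>y. y \<in> E \<Longrightarrow> \<bar>blinfun_apply b y\<bar> \<le> c) \<Longrightarrow> dual_seminorm E b \<le> c"
  unfolding dual_seminorm_def using E(1) by (rule cSUP_least)

lemma dual_seminorm_nonneg: "0 \<le> dual_seminorm E b"
  using E(1) apply_le_dual_seminorm[of _ b] by (meson abs_ge_zero all_not_in_conv order_trans)

lemma dual_seminorm_triangle: "dual_seminorm E (a - b) \<le> dual_seminorm E (a - c) + dual_seminorm E (b - c)"
proof (rule dual_seminorm_least)
  fix y assume y: "y \<in> E"
  have "(a - b) y = (a - c) y - (b - c) y" by (simp add: blinfun.diff_left)
  then show "\<bar>blinfun_apply (a - b) y\<bar> \<le> dual_seminorm E (a - c) + dual_seminorm E (b - c)"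
    using apply_le_dual_seminorm[OF y, of "a - c"] apply_le_dual_seminorm[OF y, of "b - c"] by linarith
qed

lemma dual_seminorm_midpoint:
  "dual_seminorm E ((1/2) *\<^sub>R (a + b) - c) \<le> (dual_seminorm E (a - c) + dual_seminorm E (b - c)) / 2"
proof (rule dual_seminorm_least)
  fix y assume y: "y \<in> E"
  have "((1/2) *\<^sub>R (a + b) - c) y = ((a - c) y + (b - c) y) / 2"
    by (simp add: blinfun.diff_left blinfun.scaleR_left blinfun.add_left field_simps)
  moreover have "\<bar>(a - c) y + (b - c) y\<bar> \<le> dual_seminorm E (a - c) + dual_seminorm E (b - c)"
    using abs_triangle_ineq add_mono[OF apply_le_dual_seminorm[OF y] apply_le_dual_seminorm[OF y]]
    by (rule order_trans)
  ultimately show "\<bar>((1/2) *\<^sub>R (a + b) - c) y\<bar> \<le> (dual_seminorm E (a - c) + dual_seminorm E (b - c)) / 2"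
    by simp
qed

lemma dual_seminorm_approx:
  obtains y where "\<And>m. y m \<in> E" "(\<lambda>m::nat. \<bar>blinfun_apply b (y m)\<bar>) \<longlonglongrightarrow> dual_seminorm E b"
proof -
  have "\<exists>y\<in>E. dual_seminorm E b - 1 / (real m + 1) < \<bar>blinfun_apply b y\<bar>" for m :: nat
    using less_cSUP_iff[OF E(1) dual_seminorm_bdd, of "dual_seminorm E b - 1 / (real m + 1)" b]
    by (simp add: dual_seminorm_def)
  then obtain y where y: "\<And>m. y m \<in> E" "\<And>m. dual_seminorm E b - 1 / (real m + 1) < \<bar>blinfun_apply b (y m)\<bar>"
    by metis
  have "(\<lambda>m::nat. \<bar>blinfun_apply b (y m)\<bar>) \<longlonglongrightarrow> dual_seminorm E b"
  proof (rule tendsto_sandwich)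
    show "(\<lambda>m. dual_seminorm E b - 1 / (real m + 1)) \<longlonglongrightarrow> dual_seminorm E b"
      using tendsto_diff[OF tendsto_const LIMSEQ_inverse_real_of_nat, of "dual_seminorm E b"]
      by (simp add: inverse_eq_divide add.commute)
    show "\<forall>\<^sub>F m in sequentially. dual_seminorm E b - 1 / (real m + 1) \<le> \<bar>blinfun_apply b (y m)\<bar>"
      using y(2) by (simp add: less_imp_le)
    show "\<forall>\<^sub>F m in sequentially. \<bar>blinfun_apply b (y m)\<bar> \<le> dual_seminorm E b"
      using apply_le_dual_seminorm y(1) by simp
  qed simp
  with y(1) show ?thesis using that by blast
qed

context
  fixes d :: "nat \<Rightarrow> 'a \<Rightarrow>\<^sub>L real" and s :: real
  assumes d: "\<And>k. norm (d k) \<le> 1" and s: "0 < s"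
begin

text \<open>The penalty is weak* lower semicontinuous, and controls the distances to all points of a
  dense sequence; this makes its conjugate Frechet differentiable along \<open>E\<close>.\<close>

definition penalty :: "('a \<Rightarrow>\<^sub>L real) \<Rightarrow> real" where
  "penalty b = (\<Sum>k. s / 8 * (1/2)^k * (dual_seminorm E (b - d k))\<^sup>2)"

text \<open>Without the penalty this is the norm, by duality; a penalty with values between 0 and
  \<open>s\<close> lowers it by at most \<open>s\<close>.\<close>

definition smoothed_norm :: "'a \<Rightarrow> real" where
  "smoothed_norm v = (SUP b\<in>{b. norm b \<le> 1}. blinfun_apply b v - penalty b)"

text \<open>The factor 1/8 is explained here: points of the dual ball have seminorm distance at most
  2, with square 4, and the geometric weights then sum to \<open>s\<close>.\<close>

lemma penalty_term_le:
  assumes "norm b \<le> 1"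
  shows "s / 8 * (1/2)^k * (dual_seminorm E (b - d k))\<^sup>2 \<le> s / 2 * (1/2)^k"
proof -
  have "dual_seminorm E (b - d k) \<le> 2"
    using dual_seminorm_le_norm[of "b - d k"] norm_triangle_ineq4[of b "d k"] assms d[of k] by linarith
  then have "(dual_seminorm E (b - d k))\<^sup>2 \<le> 2\<^sup>2"
    using dual_seminorm_nonneg by (rule power_mono)
  then have "s / 8 * (1/2)^k * (dual_seminorm E (b - d k))\<^sup>2 \<le> s / 8 * (1/2)^k * 2\<^sup>2"
    using s by (intro mult_left_mono) auto
  then show ?thesis by simp
qed

lemma penalty_term_nonneg: "0 \<le> s / 8 * (1/2)^k * (dual_seminorm E (b - d k))\<^sup>2"
  using s by simp

lemma penalty_summable:
  assumes "norm b \<le> 1"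
  shows "summable (\<lambda>k. s / 8 * (1/2)^k * (dual_seminorm E (b - d k))\<^sup>2)"
proof (rule summable_comparison_test[of _ "\<lambda>k. s / 2 * (1/2)^k"])
  show "\<exists>N. \<forall>k\<ge>N. norm (s / 8 * (1/2)^k * (dual_seminorm E (b - d k))\<^sup>2) \<le> s / 2 * (1/2)^k"
    using penalty_term_le[OF assms] penalty_term_nonneg by simp
qed (simp add: summable_mult summable_geometric)

lemma penalty_bounds:
  assumes "norm b \<le> 1"
  shows "0 \<le> penalty b" "penalty b \<le> s"
proof -
  show "0 \<le> penalty b"
    unfolding penalty_def by (intro suminf_nonneg penalty_summable assms penalty_term_nonneg)
  have "penalty b \<le> (\<Sum>k. s / 2 * (1/2)^k)"
    unfolding penalty_def
    by (intro suminf_le penalty_summable assms penalty_term_le summable_mult summable_geometric) simp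
  also have "\<dots> = s" by (subst suminf_mult) (simp_all add: suminf_geometric)
  finally show "penalty b \<le> s" .
qed

text \<open>The penalty is a supremum of finite sums of squares of evaluations. Each such sum is
  continuous for pointwise convergence, whence weak* lower semicontinuity.\<close>

lemma penalty_le_iff:
  assumes "norm b \<le> 1"
  shows "penalty b \<le> r \<longleftrightarrow>
    (\<forall>N. \<forall>y. (\<forall>k. y k \<in> E) \<longrightarrow> (\<Sum>k<N. s / 8 * (1/2)^k * (blinfun_apply b (y k) - blinfun_apply (d k) (y k))\<^sup>2) \<le> r)"
proof safe
  fix N :: nat and y :: "nat \<Rightarrow> 'a"
  assume r: "penalty b \<le> r" and y: "\<forall>k. y k \<in> E"
  have "(\<Sum>k<N. s / 8 * (1/2)^k * (b (y k) - d k (y k))\<^sup>2) \<le> (\<Sum>k<N. s / 8 * (1/2)^k * (dual_seminorm E (b - d k))\<^sup>2)"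
  proof (intro sum_mono mult_left_mono)
    fix k
    have "\<bar>b (y k) - d k (y k)\<bar> \<le> dual_seminorm E (b - d k)"
      using apply_le_dual_seminorm[of "y k" "b - d k"] y by (simp add: blinfun.diff_left)
    then show "(b (y k) - d k (y k))\<^sup>2 \<le> (dual_seminorm E (b - d k))\<^sup>2"
      using power_mono[of "\<bar>b (y k) - d k (y k)\<bar>" _ 2] by simp
  qed (use s in simp)
  also have "\<dots> \<le> penalty b"
    unfolding penalty_def by (intro sum_le_suminf penalty_summable assms) (auto simp: s less_imp_le)
  finally show "(\<Sum>k<N. s / 8 * (1/2)^k * (b (y k) - d k (y k))\<^sup>2) \<le> r" using r by simp
next
  assume *: "\<forall>N. \<forall>y. (\<forall>k. y k \<in> E) \<longrightarrow> (\<Sum>k<N. s / 8 * (1/2)^k * (b (y k) - d k (y k))\<^sup>2) \<le> r"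
  have "\<exists>y. (\<forall>m. y m \<in> E) \<and> (\<lambda>m::nat. \<bar>blinfun_apply (b - d k) (y m)\<bar>) \<longlonglongrightarrow> dual_seminorm E (b - d k)" for k
    by (rule dual_seminorm_approx[of "b - d k"]) blast
  then obtain y where y: "\<And>k m. y k m \<in> E"
    "\<And>k. (\<lambda>m::nat. \<bar>blinfun_apply (b - d k) (y k m)\<bar>) \<longlonglongrightarrow> dual_seminorm E (b - d k)"
    by metis
  show "penalty b \<le> r"
    unfolding penalty_def
  proof (rule suminf_le_const[OF penalty_summable[OF assms]])
    fix N
    have "(\<lambda>m. \<Sum>k<N. s / 8 * (1/2)^k * \<bar>blinfun_apply (b - d k) (y k m)\<bar>\<^sup>2)
        \<longlonglongrightarrow> (\<Sum>k<N. s / 8 * (1/2)^k * (dual_seminorm E (b - d k))\<^sup>2)"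
      by (intro tendsto_intros y(2))
    moreover have "(\<Sum>k<N. s / 8 * (1/2)^k * \<bar>blinfun_apply (b - d k) (y k m)\<bar>\<^sup>2) \<le> r" for m
      using *[rule_format, of "\<lambda>k. y k m" N] y(1) by (simp add: blinfun.diff_left)
    ultimately show "(\<Sum>k<N. s / 8 * (1/2)^k * (dual_seminorm E (b - d k))\<^sup>2) \<le> r"
      by (intro LIMSEQ_le_const2) auto
  qed
qed

lemma dual_ball_apply_le: "norm b \<le> 1 \<Longrightarrow> \<bar>blinfun_apply b v\<bar> \<le> norm v"
  using norm_blinfun[of b v] mult_right_mono[of "norm b" 1 "norm v"] by simp

lemma smoothed_norm_bdd: "bdd_above ((\<lambda>b. blinfun_apply b v - penalty b) ` {b. norm b \<le> 1})"
proof (rule bdd_aboveI2)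
  fix b :: "'a \<Rightarrow>\<^sub>L real" assume "b \<in> {b. norm b \<le> 1}"
  then show "blinfun_apply b v - penalty b \<le> norm v"
    using dual_ball_apply_le[of b v] penalty_bounds(1)[of b] by simp
qed

lemma smoothed_norm_ge: "norm b \<le> 1 \<Longrightarrow> blinfun_apply b v - penalty b \<le> smoothed_norm v"
  unfolding smoothed_norm_def by (rule cSUP_upper[OF _ smoothed_norm_bdd]) simp

text \<open>The superlevel sets of the maximized expression are cut out by closed conditions on
  evaluations, so weak* compactness applies. The maximizer later serves as the slope of the smoothed
  norm.\<close>

lemma smoothed_norm_attained:
  obtains a where "norm a \<le> 1" "smoothed_norm v = blinfun_apply a v - penalty a"
proof -
  define K where "K = (\<lambda>t. {f :: 'a \<Rightarrow> real. \<forall>N. \<forall>y. (\<forall>k. y k \<in> E) \<longrightarrow>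
    (\<Sum>k<N. s / 8 * (1/2)^k * (f (y k) - blinfun_apply (d k) (y k))\<^sup>2) \<le> f v - t})"
  have "closed (K t)" for t
    unfolding K_def
    by (intro closed_Collect_all closed_Collect_imp closed_Collect_le continuous_intros
        continuous_on_product_coordinates) simp
  moreover have "blinfun_apply a \<in> K t \<longleftrightarrow> t \<le> blinfun_apply a v - penalty a" if "norm a \<le> 1" for a t
    using penalty_le_iff[OF that, of "blinfun_apply a v - t"] by (auto simp: K_def)
  ultimately obtain a where a: "norm a \<le> 1"
    "\<And>b. norm b \<le> 1 \<Longrightarrow> blinfun_apply b v - penalty b \<le> blinfun_apply a v - penalty a"
    by (rule dual_ball_attains_sup[OF _ _ smoothed_norm_bdd[of v]]) blast+
  have "smoothed_norm v \<le> blinfun_apply a v - penalty a"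
    unfolding smoothed_norm_def using a(2) by (intro cSUP_least) (auto intro: exI[of _ 0])
  then show ?thesis using smoothed_norm_ge[OF a(1), of v] by (intro that[OF a(1)]) simp
qed

lemma smoothed_norm_le_norm: "smoothed_norm v \<le> norm v"
  by (rule smoothed_norm_attained[of v]) (use dual_ball_apply_le[of _ v] penalty_bounds(1) in force)

lemma smoothed_norm_ge_norm: "norm v - s \<le> smoothed_norm v"
proof -
  \<comment> \<open>For this single pair, Hahn-Banach yields a norming functional of
    \<open>v\<close>.\<close>
  have "0 \<le> 1 * norm k + c" if "(k, c) \<in> convex hull {(- v, - norm v)}" for k c
    using that by simp
  then obtain b :: "'a \<Rightarrow>\<^sub>L real" where "norm b \<le> 1" "blinfun_apply b (- v) \<le> - norm v"
    using bounded_functional_exists[of "{(- v, - norm v)}" 1] by auto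
  then show ?thesis
    using smoothed_norm_ge[of b v] penalty_bounds(2)[of b] by (simp add: blinfun.minus_right)
qed

lemma smoothed_norm_lipschitz: "smoothed_norm v \<le> smoothed_norm w + norm (v - w)"
proof -
  obtain a where a: "norm a \<le> 1" "smoothed_norm v = blinfun_apply a v - penalty a"
    by (rule smoothed_norm_attained)
  have "a v = a w + a (v - w)" by (simp add: blinfun.diff_right)
  then show ?thesis
    using smoothed_norm_ge[OF a(1), of w] dual_ball_apply_le[OF a(1), of "v - w"] a(2) by linarith
qed

text \<open>The square gains a quarter of the squared difference at a midpoint. The gain of the
  \<open>k\<close>-th summand is kept, and those of the others are nonnegative.\<close>

lemma penalty_midpoint:
  assumes "norm a \<le> 1" "norm b \<le> 1"
  shows "penalty ((1/2) *\<^sub>R (a + b)) + s / 8 * (1/2)^k * (dual_seminorm E (a - d k) - dual_seminorm E (b - d k))\<^sup>2 / 4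
    \<le> (penalty a + penalty b) / 2"
proof -
  let ?N = "\<lambda>b k. dual_seminorm E (b - d k)"
  let ?w = "\<lambda>k::nat. s / 8 * (1/2)^k"
  let ?m = "(1/2) *\<^sub>R (a + b)"
  have m: "norm ?m \<le> 1"
    using norm_triangle_ineq[of a b] assms by simp
  let ?D = "\<lambda>j. ?w j * (?N a j)\<^sup>2 / 2 + ?w j * (?N b j)\<^sup>2 / 2 - ?w j * (?N ?m j)\<^sup>2"
  have D: "?w j * ((?N a j - ?N b j)\<^sup>2 / 4) \<le> ?D j" for j
  proof -
    have "(?N ?m j)\<^sup>2 \<le> ((?N a j + ?N b j) / 2)\<^sup>2"
      by (intro power_mono dual_seminorm_midpoint dual_seminorm_nonneg)
    also have "\<dots> = (?N a j)\<^sup>2 / 2 + (?N b j)\<^sup>2 / 2 - (?N a j - ?N b j)\<^sup>2 / 4"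
      by (simp add: power2_eq_square field_simps)
    finally have "?w j * ((?N a j - ?N b j)\<^sup>2 / 4) \<le> ?w j * ((?N a j)\<^sup>2 / 2 + (?N b j)\<^sup>2 / 2 - (?N ?m j)\<^sup>2)"
      using s by (intro mult_left_mono) auto
    then show ?thesis by (simp add: algebra_simps)
  qed
  have D0: "0 \<le> ?D j" for j
    by (rule order_trans[OF _ D]) (use s in simp)
  have sm: "?D sums (penalty a / 2 + penalty b / 2 - penalty ?m)"
    unfolding penalty_def
    by (intro sums_diff sums_add sums_divide summable_sums penalty_summable assms m)
  have "sum ?D {k} \<le> suminf ?D"
    using sm D0 by (intro sum_le_suminf) (auto simp: sums_iff)
  then have "?w k * ((?N a k - ?N b k)\<^sup>2 / 4) \<le> penalty a / 2 + penalty b / 2 - penalty ?m"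
    using D[of k] sums_unique[OF sm] by simp
  then show ?thesis by (simp add: field_simps)
qed

text \<open>An argument in the style of Smulyan's test: a maximizer \<open>b\<close> at
  \<open>v + h\<close> almost maximizes at \<open>v\<close>, so the gain at the midpoint of
  \<open>a\<close> and \<open>b\<close> is small. Both then have almost the same distance to every
  \<open>d k\<close>; choosing \<open>d k\<close> near \<open>a\<close> makes \<open>b\<close> near
  \<open>a\<close>, hence \<open>(b - a) h\<close> small in the admissible directions.\<close>

lemma smoothed_norm_superdifferentiable:
  assumes dense: "\<And>b e. norm b \<le> 1 \<Longrightarrow> 0 < e \<Longrightarrow> \<exists>k. dual_seminorm E (b - d k) \<le> e"
  obtains a where "norm a \<le> 1"
    "\<And>e. 0 < e \<Longrightarrow> \<exists>\<delta>>0. \<forall>h. norm h < \<delta> \<longrightarrow> (\<forall>b. \<bar>blinfun_apply b h\<bar> \<le> dual_seminorm E b * norm h) \<longrightarrow>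
      smoothed_norm (v + h) \<le> smoothed_norm v + blinfun_apply a h + e * norm h"
proof -
  obtain a where a: "norm a \<le> 1" "smoothed_norm v = blinfun_apply a v - penalty a"
    by (rule smoothed_norm_attained)
  show ?thesis
  proof (rule that[OF a(1)])
    fix e :: real assume e: "0 < e"
    obtain k where k: "dual_seminorm E (a - d k) \<le> e / 3"
      using dense[OF a(1), of "e / 3"] e by auto
    define w where "w = s / 8 * (1/2)^k"
    have w: "0 < w" using s by (simp add: w_def)
    \<comment> \<open>Chosen so that a midpoint gain of at most \<open>norm h\<close> makes the
      distances of \<open>a\<close> and \<open>b\<close> to \<open>d k\<close> differ by at most
      \<open>e / 3\<close>.\<close>
    define \<delta> where "\<delta> = w * (e / 3)\<^sup>2 / 4"
    have "smoothed_norm (v + h) \<le> smoothed_norm v + a h + e * norm h"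
      if h: "norm h < \<delta>" "\<And>b. \<bar>blinfun_apply b h\<bar> \<le> dual_seminorm E b * norm h" for h
    proof -
      obtain b where b: "norm b \<le> 1" "smoothed_norm (v + h) = blinfun_apply b (v + h) - penalty b"
        by (rule smoothed_norm_attained)
      let ?m = "(1/2) *\<^sub>R (a + b)"
      \<comment> \<open>One \<open>norm h\<close> is lost in the supremum and one in evaluating
        \<open>b\<close>; averaging with the exact maximizer \<open>a\<close> halves the loss, which
        then bounds the midpoint gain.\<close>
      have near: "smoothed_norm v - 2 * norm h \<le> b v - penalty b"
        using smoothed_norm_lipschitz[of v "v + h"] b dual_ball_apply_le[OF b(1), of h]
        by (simp add: blinfun.add_right)
      have "norm ?m \<le> 1"
        using norm_triangle_ineq[of a b] a(1) b(1) by simp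
      then have "?m v - penalty ?m \<le> smoothed_norm v" by (rule smoothed_norm_ge)
      moreover have "?m v = (a v + b v) / 2"
        by (simp add: blinfun.scaleR_left blinfun.add_left)
      moreover define Z where "Z = w * (dual_seminorm E (a - d k) - dual_seminorm E (b - d k))\<^sup>2 / 4"
      moreover have "penalty ?m + Z \<le> (penalty a + penalty b) / 2"
        using penalty_midpoint[OF a(1) b(1), of k] by (simp add: Z_def w_def)
      ultimately have "Z \<le> norm h"
        using near a(2) by (simp add: field_simps)
      then have "w * (dual_seminorm E (a - d k) - dual_seminorm E (b - d k))\<^sup>2 / 4 \<le> norm h"
        by (simp add: Z_def)
      then have "w * (dual_seminorm E (a - d k) - dual_seminorm E (b - d k))\<^sup>2 \<le> w * (e / 3)\<^sup>2"
        using h(1) by (simp add: \<delta>_def)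
      then have "(dual_seminorm E (b - d k) - dual_seminorm E (a - d k))\<^sup>2 \<le> (e / 3)\<^sup>2"
        using w by (simp add: power2_commute)
      then have "dual_seminorm E (b - d k) - dual_seminorm E (a - d k) \<le> e / 3"
        by (rule power2_le_imp_le) (use e in simp)
      then have "dual_seminorm E (b - a) \<le> e"
        using dual_seminorm_triangle[of b a "d k"] k by linarith
      then have "dual_seminorm E (b - a) * norm h \<le> e * norm h"
        by (rule mult_right_mono) simp
      then have "(b - a) h \<le> e * norm h"
        using h(2)[of "b - a"] by linarith
      then show ?thesis
        using b(2) smoothed_norm_ge[OF b(1), of v] by (simp add: blinfun.diff_left blinfun.add_right)
    qed
    moreover have "0 < \<delta>" using w e by (simp add: \<delta>_def)
    ultimately show "\<exists>\<delta>>0. \<forall>h. norm h < \<delta> \<longrightarrow> (\<forall>b. \<bar>blinfun_apply b h\<bar> \<le> dual_seminorm E b * norm h) \<longrightarrow>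
      smoothed_norm (v + h) \<le> smoothed_norm v + blinfun_apply a h + e * norm h"
      by blast
  qed
qed

end

end

section \<open>A smooth variational principle\<close>

lemma approximate_minimizer:
  fixes g :: "'a \<Rightarrow> real"
  assumes "S \<noteq> {}" "bdd_below (g ` S)" "0 < e"
  obtains u where "u \<in> S" "\<And>w. w \<in> S \<Longrightarrow> g u \<le> g w + e"
proof -
  obtain u where u: "u \<in> S" "g u < Inf (g ` S) + e"
    using cInf_lessD[of "g ` S" "Inf (g ` S) + e"] assms by auto
  show ?thesis
  proof (rule that[OF u(1)])
    fix w assume "w \<in> S"
    then show "g u \<le> g w + e"
      using cINF_lower[OF assms(2), of w] u(2) by simp
  qed
qed

text \<open>Perturbing by smoothed norms instead of the norm (as in Ekeland's principle) costs the
  closeness of each step an amount equal to the smoothing error, which is taken summable.\<close>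

lemma smooth_variational_principle:
  fixes S :: "'a::banach set" and q :: "nat \<Rightarrow> 'a \<Rightarrow> real"
  assumes S: "closed S" "x0 \<in> S"
    and \<phi>: "\<And>v w. \<phi> v \<le> \<phi> w + K * norm (v - w)"
    and q: "\<And>n h. q n h \<le> norm h" "\<And>n h. norm h - \<rho> / 2^n \<le> q n h" "\<And>n v w. q n v \<le> q n w + norm (v - w)"
    and pos: "0 < \<kappa>" "0 < \<rho>"
    and x0: "\<And>w. w \<in> S \<Longrightarrow> \<phi> x0 \<le> \<phi> w + \<kappa> * \<rho> / 2"
  obtains u z where "z \<in> S" "norm (z - x0) \<le> 6 * \<rho>"
    "\<And>w. summable (\<lambda>n. \<kappa> / 2^Suc n * q n (w - u n))"
    "\<And>w. w \<in> S \<Longrightarrow> \<phi> z + (\<Sum>n. \<kappa> / 2^Suc n * q n (z - u n)) \<le> \<phi> w + (\<Sum>n. \<kappa> / 2^Suc n * q n (w - u n))"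
proof -
  define c where "c = (\<lambda>n. \<kappa> / 2^Suc n)"
  \<comment> \<open>The slack equals \<open>c n\<close> times the smoothing error
    \<open>\<rho> / 2^n\<close>. A step is thus at most \<open>3 * \<rho> / 2^n\<close>: once from
    smoothing, twice from the slacks of two consecutive points; the steps add up to
    \<open>6 * \<rho>\<close>.\<close>
  define e where "e = (\<lambda>n::nat. \<kappa> * \<rho> / (2 * 4^n))"
  have c: "0 < c n" and e: "0 < e n" for n
    using pos by (auto simp: c_def e_def)
  \<comment> \<open>The state carries the perturbed function along with the point, because the
    function depends on all earlier points; the clause for \<open>n = 0\<close> fixes the
    start.\<close>
  define P where "P = (\<lambda>n (f :: 'a \<Rightarrow> real, v). v \<in> S \<and> (\<forall>w\<in>S. f v \<le> f w + e n) \<and> (n = 0 \<longrightarrow> f = \<phi> \<and> v = x0))"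
  define Q where "Q = (\<lambda>n (f :: 'a \<Rightarrow> real, v) (f', v' :: 'a). f' = (\<lambda>w. f w + c n * q n (w - v)))"
  have "\<exists>s. \<forall>n. P n (s n) \<and> Q n (s n) (s (Suc n))"
  proof (rule dependent_nat_choice)
    show "\<exists>x. P 0 x"
      using S x0 by (intro exI[of _ "(\<phi>, x0)"]) (simp add: P_def e_def)
    fix x n assume Px: "P n x"
    obtain f v where x: "x = (f, v)" by (cases x)
    define f' where "f' = (\<lambda>w. f w + c n * q n (w - v))"
    have "bdd_below (f' ` S)"
    proof (rule bdd_belowI2)
      fix w assume "w \<in> S"
      then have "f v - e n \<le> f w" using Px by (force simp: P_def x)
      moreover have "- (\<rho> / 2^n) \<le> q n (w - v)"
        using q(2)[of "w - v" n] norm_ge_zero[of "w - v"] by linarith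
      then have "c n * - (\<rho> / 2^n) \<le> c n * q n (w - v)"
        using c[of n] by (intro mult_left_mono) auto
      ultimately show "f v - e n + c n * - (\<rho> / 2^n) \<le> f' w"
        by (simp add: f'_def)
    qed
    then obtain v' where "v' \<in> S" "\<And>w. w \<in> S \<Longrightarrow> f' v' \<le> f' w + e (Suc n)"
      using approximate_minimizer[of S f' "e (Suc n)"] S e by blast
    then show "\<exists>y. P (Suc n) y \<and> Q n x y"
      by (intro exI[of _ "(f', v')"]) (simp add: P_def Q_def x f'_def)
  qed
  then obtain s where s: "\<And>n. P n (s n)" "\<And>n. Q n (s n) (s (Suc n))" by blast
  define f where "f = (\<lambda>n. fst (s n))"
  define u where "u = (\<lambda>n. snd (s n))"
  have uS: "u n \<in> S" and fmin: "w \<in> S \<Longrightarrow> f n (u n) \<le> f n w + e n" for n w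
    using s(1)[of n] by (auto simp: P_def f_def u_def split: prod.splits)
  have f0: "f 0 = \<phi>" and u0: "u 0 = x0"
    using s(1)[of 0] by (auto simp: P_def f_def u_def split: prod.splits)
  have fSuc: "f (Suc n) w = f n w + c n * q n (w - u n)" for n w
    using s(2)[of n] by (auto simp: Q_def f_def u_def split: prod.splits)
  have f: "f n w = \<phi> w + (\<Sum>k<n. c k * q k (w - u k))" for n w
    by (induction n) (simp_all add: f0 fSuc)
  have step: "norm (u (Suc n) - u n) \<le> 3 * \<rho> / 2^n" for n
  proof -
    have "c n * (norm (u (Suc n) - u n) - \<rho> / 2^n) \<le> c n * q n (u (Suc n) - u n)"
      using c[of n] q(2) by (intro mult_left_mono) auto
    also have "\<dots> = f (Suc n) (u (Suc n)) - f n (u (Suc n))"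
      by (simp add: fSuc)
    also have "f (Suc n) (u (Suc n)) \<le> f (Suc n) (u n) + e (Suc n)"
      by (rule fmin[OF uS])
    also have "f (Suc n) (u n) \<le> f n (u n)"
    proof -
      have "c n * q n 0 \<le> 0" using c[of n] q(1)[of n 0] by (simp add: mult_nonneg_nonpos)
      then show ?thesis by (simp add: fSuc)
    qed
    also have "f n (u n) \<le> f n (u (Suc n)) + e n"
      by (rule fmin[OF uS])
    finally have "c n * (norm (u (Suc n) - u n) - \<rho> / 2^n) \<le> e (Suc n) + e n" by simp
    also have "e (Suc n) \<le> e n" using pos by (simp add: e_def field_simps)
    also have "e n + e n = c n * (2 * (\<rho> / 2^n))"
    proof -
      have "(4::real)^n = 2^n * 2^n" by (simp flip: power_mult_distrib)
      then show ?thesis by (simp add: e_def c_def)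
    qed
    finally have "c n * (norm (u (Suc n) - u n) - \<rho> / 2^n) \<le> c n * (2 * (\<rho> / 2^n))" by simp
    then have "norm (u (Suc n) - u n) - \<rho> / 2^n \<le> 2 * (\<rho> / 2^n)"
      using c[of n] mult_le_cancel_left_pos by blast
    then show ?thesis by simp
  qed
  have geo: "summable (\<lambda>n. 3 * \<rho> / 2^n)" "(\<Sum>n. 3 * \<rho> / 2^n) = 6 * \<rho>"
  proof -
    have "(\<lambda>n. 3 * \<rho> * (1/2)^n) sums (3 * \<rho> * (1 / (1 - 1/2)))"
      by (rule sums_mult[OF geometric_sums]) simp
    then have "(\<lambda>n. 3 * \<rho> / 2^n) sums (6 * \<rho>)" by (simp add: power_one_over)
    then show "summable (\<lambda>n. 3 * \<rho> / 2^n)" "(\<Sum>n. 3 * \<rho> / 2^n) = 6 * \<rho>"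
      by (auto simp: sums_iff)
  qed
  have dist_x0: "norm (u n - x0) \<le> 6 * \<rho>" for n
  proof -
    have "u n - x0 = (\<Sum>k<n. u (Suc k) - u k)"
      by (simp add: sum_lessThan_telescope u0)
    then have "norm (u n - x0) \<le> (\<Sum>k<n. 3 * \<rho> / 2^k)"
      by (simp add: sum_norm_le step)
    also have "\<dots> \<le> (\<Sum>k. 3 * \<rho> / 2^k)"
      using pos by (intro sum_le_suminf geo(1)) auto
    finally show ?thesis using geo(2) by simp
  qed
  have "summable (\<lambda>n. u (Suc n) - u n)"
    by (rule summable_comparison_test[OF _ geo(1)]) (use step in blast)
  then have "convergent u"
    by (simp add: telescope_summable' summable_iff_convergent sum_lessThan_telescope convergent_diff_const_right_iff)
  then obtain z where z: "u \<longlonglongrightarrow> z" by (auto simp: convergent_def)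
  have zS: "z \<in> S" by (rule closed_sequentially[OF S(1) uS z])
  have "norm (z - x0) \<le> 6 * \<rho>"
    by (rule Lim_bounded[OF tendsto_norm[OF tendsto_diff[OF z tendsto_const]], of 0]) (use dist_x0 in blast)
  moreover have sm: "summable (\<lambda>n. c n * q n (w - u n))" for w
  proof (rule summable_comparison_test)
    have "\<bar>q n (w - u n)\<bar> \<le> norm (w - x0) + 7 * \<rho>" for n
    proof -
      have "norm (w - u n) \<le> norm (w - x0) + 6 * \<rho>"
        using norm_triangle_ineq4[of "w - x0" "u n - x0"] dist_x0[of n] by simp
      moreover have "\<rho> / 2^n \<le> \<rho>" using pos by (simp add: divide_le_eq)
      ultimately show ?thesis
        using q(1)[of n "w - u n"] q(2)[of "w - u n" n] norm_ge_zero[of "w - u n"]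
          norm_ge_zero[of "w - x0"] pos(2) by (intro abs_leI) linarith+
    qed
    then have "\<bar>c n * q n (w - u n)\<bar> \<le> c n * (norm (w - x0) + 7 * \<rho>)" for n
      using c[of n] by (simp add: abs_mult mult_left_mono)
    then show "\<exists>N. \<forall>n\<ge>N. norm (c n * q n (w - u n)) \<le> c n * (norm (w - x0) + 7 * \<rho>)"
      by simp
    have "summable (\<lambda>n. \<kappa> / 2 * (1/2)^n * (norm (w - x0) + 7 * \<rho>))"
      by (intro summable_mult2 summable_mult summable_geometric) simp
    then show "summable (\<lambda>n. c n * (norm (w - x0) + 7 * \<rho>))"
      by (simp add: c_def power_one_over)
  qed
  moreover have "\<phi> z + (\<Sum>n. c n * q n (z - u n)) \<le> \<phi> w + (\<Sum>n. c n * q n (w - u n))" if w: "w \<in> S" for w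
  proof -
    have lim: "(\<lambda>n. f n v) \<longlonglongrightarrow> \<phi> v + (\<Sum>n. c n * q n (v - u n))" for v
      unfolding f by (intro tendsto_add tendsto_const summable_LIMSEQ sm)
    have c_sum: "(\<Sum>k<n. c k) \<le> \<kappa>" for n
    proof -
      have "(\<Sum>k<n. c k) = \<kappa> - \<kappa> / 2^n"
        by (induction n) (simp_all add: c_def)
      then show ?thesis using pos by simp
    qed
    \<comment> \<open>Approximate minimality of \<open>u n\<close> passes to the limit
      \<open>z\<close> because all \<open>f n\<close> share the Lipschitz constant
      \<open>K + \<kappa>\<close>, the weights having sum at most \<kappa>.\<close>
    have le: "f n z \<le> f n w + e n + (K + \<kappa>) * norm (z - u n)" for n
    proof -
      have "(\<Sum>k<n. c k * q k (z - u k)) \<le> (\<Sum>k<n. c k * (q k (u n - u k) + norm (z - u n)))"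
      proof (intro sum_mono mult_left_mono)
        fix k
        show "q k (z - u k) \<le> q k (u n - u k) + norm (z - u n)"
          using q(3)[of k "z - u k" "u n - u k"] by simp
        show "0 \<le> c k" using c[of k] by simp
      qed
      also have "\<dots> = (\<Sum>k<n. c k * q k (u n - u k)) + (\<Sum>k<n. c k) * norm (z - u n)"
        by (simp add: distrib_left sum.distrib sum_distrib_right)
      also have "(\<Sum>k<n. c k) * norm (z - u n) \<le> \<kappa> * norm (z - u n)"
        by (intro mult_right_mono c_sum) simp
      finally have "f n z \<le> f n (u n) + (K + \<kappa>) * norm (z - u n)"
        using \<phi>[of z "u n"] by (simp add: f algebra_simps)
      then show ?thesis using fmin[OF w, of n] by simp
    qed
    have "(\<lambda>n. f n w + e n + (K + \<kappa>) * norm (z - u n)) \<longlonglongrightarrow>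
        (\<phi> w + (\<Sum>n. c n * q n (w - u n))) + 0 + (K + \<kappa>) * norm (z - z)"
    proof (intro tendsto_intros lim z)
      have "(\<lambda>n. \<kappa> * \<rho> / 2 * (1/4)^n) \<longlonglongrightarrow> \<kappa> * \<rho> / 2 * 0"
        by (intro tendsto_mult_left LIMSEQ_realpow_zero) auto
      then show "e \<longlonglongrightarrow> 0" by (simp add: e_def power_one_over)
    qed
    then have "(\<lambda>n. f n w + e n + (K + \<kappa>) * norm (z - u n)) \<longlonglongrightarrow> \<phi> w + (\<Sum>n. c n * q n (w - u n))"
      by simp
    then show ?thesis by (rule LIMSEQ_le[OF lim]) (use le in blast)
  qed
  ultimately show ?thesis using that[of z u] zS by (simp add: c_def)
qed

text \<open>A common radius exists for finitely many terms only. In the tail, the bounds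
  \<open>g n h \<le> g n 0 + norm h\<close> and \<open>- norm h \<le> a n h\<close> limit each error
  to \<open>2 * c n * norm h\<close>.\<close>

lemma superdifferential_suminf:
  fixes g :: "nat \<Rightarrow> 'a::real_normed_vector \<Rightarrow> real" and a :: "nat \<Rightarrow> 'a \<Rightarrow>\<^sub>L real"
  assumes c: "\<And>n. 0 \<le> c n" "summable c"
    and g: "\<And>n h. g n h \<le> g n 0 + norm h" "\<And>h. summable (\<lambda>n. c n * g n h)"
    and a: "\<And>n. norm (a n) \<le> 1"
    and super: "\<And>n e. 0 < e \<Longrightarrow> \<exists>\<delta>>0. \<forall>h. norm h < \<delta> \<longrightarrow> H h \<longrightarrow> g n h \<le> g n 0 + blinfun_apply (a n) h + e * norm h"
  obtains b where "norm b \<le> suminf c"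
    "\<And>e. 0 < e \<Longrightarrow> \<exists>\<delta>>0. \<forall>h. norm h < \<delta> \<longrightarrow> H h \<longrightarrow>
      (\<Sum>n. c n * g n h) \<le> (\<Sum>n. c n * g n 0) + blinfun_apply b h + e * norm h"
proof -
  have ca: "norm (c n *\<^sub>R a n) \<le> c n" for n
    using mult_left_mono[OF a[of n] c(1)[of n]] c(1)[of n] by simp
  have sa: "summable (\<lambda>n. norm (c n *\<^sub>R a n))"
    by (rule summable_comparison_test[OF _ c(2)]) (use ca in simp)
  define b where "b = (\<Sum>n. c n *\<^sub>R a n)"
  have bs: "(\<lambda>n. c n *\<^sub>R a n) sums b"
    unfolding b_def by (rule summable_sums[OF summable_norm_cancel[OF sa]])
  have "norm b \<le> (\<Sum>n. norm (c n *\<^sub>R a n))"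
    unfolding b_def by (rule summable_norm[OF sa])
  also have "\<dots> \<le> suminf c"
    by (intro suminf_le sa c(2) ca)
  finally have "norm b \<le> suminf c" .
  moreover have "\<exists>\<delta>>0. \<forall>h. norm h < \<delta> \<longrightarrow> H h \<longrightarrow>
      (\<Sum>n. c n * g n h) \<le> (\<Sum>n. c n * g n 0) + blinfun_apply b h + e * norm h" if e: "0 < e" for e
  proof -
    \<comment> \<open>The first \<open>N\<close> terms use up \<open>e / 2\<close> and the tail,
      doubled, the other half; adding 1 avoids division by zero.\<close>
    define e' where "e' = e / (2 * (suminf c + 1))"
    have sc: "0 \<le> suminf c" using c by (simp add: suminf_nonneg)
    have e': "0 < e'" using e sc by (simp add: e'_def)
    obtain N where N: "norm (\<Sum>i. c (i + N)) < e / 4"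
      using suminf_exist_split[OF _ c(2), of "e / 4"] e by auto
    have "\<exists>\<delta>. \<forall>n. 0 < \<delta> n \<and> (\<forall>h. norm h < \<delta> n \<longrightarrow> H h \<longrightarrow> g n h \<le> g n 0 + a n h + e' * norm h)"
      using super[OF e'] by metis
    then obtain \<delta> where \<delta>: "\<And>n. 0 < \<delta> n"
      "\<And>n h. norm h < \<delta> n \<Longrightarrow> H h \<Longrightarrow> g n h \<le> g n 0 + a n h + e' * norm h" by blast
    define D where "D = Min (insert 1 (\<delta> ` {..<N}))"
    have D: "0 < D" "\<And>n. n < N \<Longrightarrow> D \<le> \<delta> n"
      using \<delta>(1) by (auto simp: D_def)
    have "(\<Sum>n. c n * g n h) \<le> (\<Sum>n. c n * g n 0) + b h + e * norm h" if h: "norm h < D" "H h" for h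
    proof -
      define t where "t = (\<lambda>n. c n * (if n < N then e' else 2))"
      have st: "summable t" and t_le: "suminf t \<le> e"
      proof -
        have "summable (\<lambda>n. t (n + N))"
          unfolding t_def using summable_ignore_initial_segment[OF c(2), of N] by (simp add: summable_mult2)
        then show st: "summable t" by (simp add: summable_iff_shift)
        have "suminf t = (\<Sum>n. t (n + N)) + sum t {..<N}"
          by (rule suminf_split_initial_segment[OF st])
        also have "(\<Sum>n. t (n + N)) = (\<Sum>n. c (n + N)) * 2"
          unfolding t_def using suminf_mult2[OF summable_ignore_initial_segment[OF c(2)], of N 2] by simp
        also have "\<dots> \<le> e / 2" using N by (simp add: abs_less_iff)
        also have "sum t {..<N} = e' * sum c {..<N}"
          by (simp add: t_def sum_distrib_left mult.commute)
        also have "\<dots> \<le> e' * (suminf c + 1)"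
          using e' sum_le_suminf[OF c(2), of "{..<N}"] c(1) by (intro mult_left_mono) auto
        also have "\<dots> = e / 2"
        proof -
          define X where "X = suminf c + 1"
          have "X \<noteq> 0" using sc by (simp add: X_def)
          then show ?thesis unfolding e'_def X_def[symmetric] by simp
        qed
        finally show "suminf t \<le> e" by simp
      qed
      have "(\<lambda>n. c n * g n h) sums (\<Sum>n. c n * g n h)" by (intro summable_sums g(2))
      moreover have "(\<lambda>n. c n * g n 0 + (c n *\<^sub>R a n) h + t n * norm h) sums
          ((\<Sum>n. c n * g n 0) + b h + suminf t * norm h)"
        by (rule sums_add[OF sums_add[OF summable_sums[OF g(2)]
            bounded_linear.sums[OF blinfun.bounded_linear_left bs]] sums_mult2[OF summable_sums[OF st]]])
      moreover have "c n * g n h \<le> c n * g n 0 + (c n *\<^sub>R a n) h + t n * norm h" for n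
      proof -
        have "g n h \<le> g n 0 + a n h + (if n < N then e' else 2) * norm h"
        proof (cases "n < N")
          case True
          then show ?thesis using \<delta>(2)[of h n] D(2)[of n] h by simp
        next
          case False
          have "- norm h \<le> a n h"
            using norm_blinfun[of "a n" h] mult_right_mono[OF a[of n], of "norm h"] by simp
          then show ?thesis using g(1)[of n h] False by simp
        qed
        from mult_left_mono[OF this c(1)[of n]] show ?thesis
          by (simp add: t_def blinfun.scaleR_left distrib_left mult.assoc)
      qed
      ultimately have "(\<Sum>n. c n * g n h) \<le> (\<Sum>n. c n * g n 0) + b h + suminf t * norm h"
        by (rule sums_le[rotated])
      then show ?thesis using mult_right_mono[OF t_le, of "norm h"] by simp
    qed
    then show ?thesis using D(1) by blast
  qed
  ultimately show ?thesis by (rule that)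
qed

section \<open>Frechet normals near epsilon-normals\<close>

text \<open>By hypothesis \<open>x\<close> minimizes
  \<open>\<eta> * norm (u - x) - xs (u - x)\<close> on \<open>A\<close>. Replacing the norm by a
  smoothed one with a slightly larger factor leaves \<open>x\<close> an approximate minimizer, and a
  nearby exact minimizer of a further perturbation yields the normal.\<close>

lemma fuzzy_frechet_normal:
  fixes A :: "'a::banach set"
  assumes asp: "asplund_space TYPE('a)" and A: "closed A" "x \<in> A"
    and \<eta>: "0 \<le> \<eta>" "\<And>u. u \<in> A \<Longrightarrow> blinfun_apply xs (u - x) \<le> \<eta> * norm (u - x)" and \<gamma>: "0 < \<gamma>"
  obtains u a where "u \<in> A" "norm (u - x) < \<gamma>" "norm (a - xs) \<le> \<eta> + \<gamma>" "a \<in> frechet_normal_cone A u"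
proof -
  have "0 \<le> \<eta> + \<gamma>" using \<eta>(1) \<gamma> by simp
  then obtain C where C: "countable C" "{x} \<subseteq> C" "C \<subseteq> A"
    "\<And>u a. u \<in> A \<inter> closure C \<Longrightarrow> norm (a - xs) \<le> \<eta> + \<gamma> \<Longrightarrow> a \<in> frechet_normal_cone (A \<inter> closure C) u \<Longrightarrow>
      \<exists>b. norm (b - xs) \<le> \<eta> + \<gamma> \<and> b \<in> frechet_normal_cone A u"
    using separable_reduction[of "{x}" A "\<eta> + \<gamma>" xs] A(2) by (metis countable_empty countable_insert empty_subsetI insert_subset)
  define S where "S = closure C"
  have S: "closed S" "x \<in> S" "S \<subseteq> A"
    using C(2,3) A(1) closure_subset[of C] by (auto simp: S_def closure_minimal dest: subsetD)
  \<comment> \<open>The pairs with \<open>v = w\<close> contribute the vector 0, since the inverse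
    of 0 is 0.\<close>
  define E where "E = (\<lambda>(v, w). (v - w) /\<^sub>R norm (v - w)) ` (C \<times> C)"
  have "inverse t * t \<le> 1" for t :: real by (cases "t = 0") simp_all
  then have E: "countable E" "E \<noteq> {}" "\<And>y. y \<in> E \<Longrightarrow> norm y \<le> 1"
    using C(1,2) by (auto simp: E_def)
  \<comment> \<open>The increments along which the smoothed norms are controlled. Differences of
    points of \<open>C\<close> qualify by the choice of \<open>E\<close>, those of points of
    \<open>S\<close> by continuity.\<close>
  define H where "H = (\<lambda>h. \<forall>b. \<bar>blinfun_apply b h\<bar> \<le> dual_seminorm E b * norm h)"
  have H: "H (v - w)" if "v \<in> S" "w \<in> S" for v w
    unfolding H_def
  proof
    fix b :: "'a \<Rightarrow>\<^sub>L real"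
    let ?T = "{z. \<bar>blinfun_apply b (fst z - snd z)\<bar> \<le> dual_seminorm E b * norm (fst z - snd z)}"
    have "C \<times> C \<subseteq> ?T"
    proof clarsimp
      fix v w assume "v \<in> C" "w \<in> C"
      then have "(v - w) /\<^sub>R norm (v - w) \<in> E" by (force simp: E_def)
      from apply_le_dual_seminorm[OF E(2,3) this, of b]
      have "\<bar>blinfun_apply b (v - w)\<bar> / norm (v - w) \<le> dual_seminorm E b"
        by (simp add: blinfun.scaleR_right abs_mult divide_inverse mult.commute)
      then show "\<bar>blinfun_apply b (v - w)\<bar> \<le> dual_seminorm E b * norm (v - w)"
        by (cases "v = w") (simp_all add: divide_le_eq)
    qed
    moreover have "closed ?T"
      by (intro closed_Collect_le continuous_intros)
    ultimately have "closure (C \<times> C) \<subseteq> ?T" by (rule closure_minimal)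
    then show "\<bar>blinfun_apply b (v - w)\<bar> \<le> dual_seminorm E b * norm (v - w)"
      using that by (auto simp: closure_Times S_def)
  qed
  obtain d :: "nat \<Rightarrow> ('a \<Rightarrow>\<^sub>L real)" where d: "\<And>k. norm (d k) \<le> 1"
    "\<And>b e. norm b \<le> 1 \<Longrightarrow> 0 < e \<Longrightarrow> \<exists>k. \<forall>y\<in>E. \<bar>blinfun_apply b y - blinfun_apply (d k) y\<bar> \<le> e"
    using asplund_dual_ball_separable[OF asp E(1,3)] by blast
  have dense: "\<exists>k. dual_seminorm E (b - d k) \<le> e" if be: "norm b \<le> 1" "0 < e" for b e
  proof -
    obtain k where "\<forall>y\<in>E. \<bar>blinfun_apply b y - blinfun_apply (d k) y\<bar> \<le> e"
      using d(2)[OF be] by blast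
    then have "dual_seminorm E (b - d k) \<le> e"
      by (intro dual_seminorm_least[OF E(2,3)]) (auto simp: blinfun.diff_left)
    then show ?thesis ..
  qed
  define p where "p = smoothed_norm E d"
  have p: "p s v \<le> norm v" "norm v - s \<le> p s v" "p s v \<le> p s w + norm (v - w)" if "0 < s" for s v w
    using smoothed_norm_le_norm[OF E(2,3) d(1) that] smoothed_norm_ge_norm[OF E(2,3) d(1) that]
      smoothed_norm_lipschitz[OF E(2,3) d(1) that] by (simp_all add: p_def)
  have psuper: "\<exists>a. norm a \<le> 1 \<and> (\<forall>e>0. \<exists>\<delta>>0. \<forall>h. norm h < \<delta> \<longrightarrow> H h \<longrightarrow>
      p s (v + h) \<le> p s v + blinfun_apply a h + e * norm h)" if "0 < s" for s v
    unfolding p_def H_def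
    by (rule smoothed_norm_superdifferentiable[OF E(2,3) d(1) that dense, of v]) blast+
  \<comment> \<open>The constants satisfy \<open>\<eta>1 + \<kappa> = \<eta> + \<gamma>\<close> and
    \<open>6 * \<rho> < \<gamma>\<close>. The smoothing error \<open>s\<close> is such that
    \<open>\<eta>1 * s\<close> is exactly the initial slack of the variational principle, and
    \<open>\<eta>1\<close> is positive even when \<eta> is 0.\<close>
  define \<kappa> where "\<kappa> = \<gamma> / 2"
  define \<rho> where "\<rho> = \<gamma> / 7"
  define \<eta>1 where "\<eta>1 = \<eta> + \<gamma> / 2"
  define s where "s = \<kappa> * \<rho> / (2 * \<eta>1)"
  have pos: "0 < \<kappa>" "0 < \<rho>" "0 < \<eta>1" using \<eta>(1) \<gamma> by (auto simp: \<kappa>_def \<rho>_def \<eta>1_def)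
  then have s: "0 < s" "\<eta>1 * s = \<kappa> * \<rho> / 2" by (simp_all add: s_def)
  have \<rho>n: "0 < \<rho> / 2^n" for n :: nat using pos by simp
  define \<phi> where "\<phi> = (\<lambda>w. \<eta>1 * p s (w - x) - blinfun_apply xs (w - x))"
  have \<phi>_lip: "\<phi> v \<le> \<phi> w + (\<eta>1 + norm xs) * norm (v - w)" for v w
  proof -
    have "\<eta>1 * p s (v - x) \<le> \<eta>1 * (p s (w - x) + norm (v - w))"
      using p(3)[OF s(1), of "v - x" "w - x"] pos by (intro mult_left_mono) auto
    moreover have "xs (w - x) - xs (v - x) \<le> norm xs * norm (v - w)"
      using norm_blinfun[of xs "w - v"] by (simp add: blinfun.diff_right norm_minus_commute)
    ultimately show ?thesis by (simp add: \<phi>_def algebra_simps)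
  qed
  have \<phi>_x: "\<phi> x \<le> \<phi> w + \<kappa> * \<rho> / 2" if "w \<in> S" for w
  proof -
    have "\<phi> x \<le> 0"
      using p(1)[OF s(1), of 0] pos(3) by (simp add: \<phi>_def mult_nonneg_nonpos)
    moreover have "\<eta>1 * (norm (w - x) - s) \<le> \<eta>1 * p s (w - x)"
      using p(2)[OF s(1)] pos by (intro mult_left_mono) auto
    moreover have "xs (w - x) \<le> \<eta> * norm (w - x)" using \<eta>(2) that S(3) by blast
    moreover have "\<eta> * norm (w - x) \<le> \<eta>1 * norm (w - x)"
      using \<gamma> by (intro mult_right_mono) (auto simp: \<eta>1_def)
    ultimately show ?thesis using s(2) by (simp add: \<phi>_def right_diff_distrib)
  qed
  define I where "I = (\<lambda>u w. \<phi> w + (\<Sum>n. \<kappa> / 2^Suc n * p (\<rho> / 2^n) (w - u n)))"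
  have "\<exists>z u. z \<in> S \<and> norm (z - x) \<le> 6 * \<rho> \<and>
      (\<forall>w. summable (\<lambda>n. \<kappa> / 2^Suc n * p (\<rho> / 2^n) (w - u n))) \<and> (\<forall>w\<in>S. I u z \<le> I u w)"
  proof (rule smooth_variational_principle[of S x \<phi> "\<eta>1 + norm xs" "\<lambda>n. p (\<rho> / 2^n)" \<rho> \<kappa>,
        OF S(1,2) \<phi>_lip p(1)[OF \<rho>n] p(2)[OF \<rho>n] p(3)[OF \<rho>n] pos(1,2)])
    fix u z
    assume 1: "z \<in> S" "norm (z - x) \<le> 6 * \<rho>"
      and 2: "\<And>w. summable (\<lambda>n. \<kappa> / 2^Suc n * p (\<rho> / 2^n) (w - u n))"
      and 3: "\<And>w. w \<in> S \<Longrightarrow> \<phi> z + (\<Sum>n. \<kappa> / 2^Suc n * p (\<rho> / 2^n) (z - u n)) \<le>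
        \<phi> w + (\<Sum>n. \<kappa> / 2^Suc n * p (\<rho> / 2^n) (w - u n))"
    show ?thesis
      by (intro exI[of _ z] exI[of _ u] conjI allI ballI 1 2) (simp only: I_def 3)
  qed (rule \<phi>_x)
  then obtain z u where zu: "z \<in> S" "norm (z - x) \<le> 6 * \<rho>"
    "\<forall>w. summable (\<lambda>n. \<kappa> / 2^Suc n * p (\<rho> / 2^n) (w - u n))" "\<forall>w\<in>S. I u z \<le> I u w"
    by blast
  note z = zu(1,2) and sm = zu(3)[rule_format] and min = zu(4)[rule_format]
  obtain a0 where a0: "norm a0 \<le> 1" "\<And>e. 0 < e \<Longrightarrow> \<exists>\<delta>>0. \<forall>h. norm h < \<delta> \<longrightarrow> H h \<longrightarrow>
      p s (z - x + h) \<le> p s (z - x) + blinfun_apply a0 h + e * norm h"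
    using psuper[OF s(1), of "z - x"] by blast
  have "\<exists>a. norm a \<le> 1 \<and> (\<forall>e>0. \<exists>\<delta>>0. \<forall>h. norm h < \<delta> \<longrightarrow> H h \<longrightarrow>
      p (\<rho> / 2^n) (z - u n + h) \<le> p (\<rho> / 2^n) (z - u n) + blinfun_apply a h + e * norm h)" for n
    by (rule psuper[OF \<rho>n])
  then obtain an where an: "\<And>n. norm (an n) \<le> 1" "\<And>n e. 0 < e \<Longrightarrow> \<exists>\<delta>>0. \<forall>h. norm h < \<delta> \<longrightarrow> H h \<longrightarrow>
      p (\<rho> / 2^n) (z - u n + h) \<le> p (\<rho> / 2^n) (z - u n) + blinfun_apply (an n) h + e * norm h"
    by metis
  have geo: "summable (\<lambda>n. \<kappa> / 2^Suc n)" "(\<Sum>n. \<kappa> / 2^Suc n) = \<kappa>"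
  proof -
    have "(\<lambda>n. \<kappa> / 2 * (1/2)^n) sums (\<kappa> / 2 * (1 / (1 - 1/2)))"
      by (rule sums_mult[OF geometric_sums]) simp
    then have "(\<lambda>n. \<kappa> / 2^Suc n) sums \<kappa>" by (simp add: power_one_over)
    then show "summable (\<lambda>n. \<kappa> / 2^Suc n)" "(\<Sum>n. \<kappa> / 2^Suc n) = \<kappa>"
      by (simp_all only: sums_iff)
  qed
  define G where "G = (\<lambda>h. \<Sum>n. \<kappa> / 2^Suc n * p (\<rho> / 2^n) (z - u n + h))"
  have "\<exists>b. norm b \<le> \<kappa> \<and> (\<forall>e>0. \<exists>\<delta>>0. \<forall>h. norm h < \<delta> \<longrightarrow> H h \<longrightarrow>
      G h \<le> G 0 + blinfun_apply b h + e * norm h)"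
  proof (rule superdifferential_suminf[of "\<lambda>n. \<kappa> / 2^Suc n" "\<lambda>n h. p (\<rho> / 2^n) (z - u n + h)" an H])
    show "0 \<le> \<kappa> / 2^Suc n" for n using pos by simp
    show "summable (\<lambda>n. \<kappa> / 2^Suc n)" by (rule geo)
    show "norm (an n) \<le> 1" for n by (rule an)
    show "p (\<rho> / 2^n) (z - u n + h) \<le> p (\<rho> / 2^n) (z - u n + 0) + norm h" for n h
      using p(3)[OF \<rho>n, of n "z - u n + h" "z - u n"] by simp
    show "summable (\<lambda>n. \<kappa> / 2^Suc n * p (\<rho> / 2^n) (z - u n + h))" for h
      using sm[of "z + h"] by (simp add: algebra_simps)
    show "\<exists>\<delta>>0. \<forall>h. norm h < \<delta> \<longrightarrow> H h \<longrightarrow> p (\<rho> / 2^n) (z - u n + h)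
        \<le> p (\<rho> / 2^n) (z - u n + 0) + blinfun_apply (an n) h + e * norm h" if "0 < e" for n e
      using an(2)[OF that, of n] by simp
  next
    fix b assume "norm b \<le> (\<Sum>n. \<kappa> / 2^Suc n)" and
      "\<And>e. 0 < e \<Longrightarrow> \<exists>\<delta>>0. \<forall>h. norm h < \<delta> \<longrightarrow> H h \<longrightarrow>
        (\<Sum>n. \<kappa> / 2^Suc n * p (\<rho> / 2^n) (z - u n + h)) \<le>
        (\<Sum>n. \<kappa> / 2^Suc n * p (\<rho> / 2^n) (z - u n + 0)) + blinfun_apply b h + e * norm h"
    then show ?thesis unfolding geo(2) G_def by blast
  qed
  then obtain b where b: "norm b \<le> \<kappa>" "\<And>e. 0 < e \<Longrightarrow> \<exists>\<delta>>0. \<forall>h. norm h < \<delta> \<longrightarrow> H h \<longrightarrow>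
      G h \<le> G 0 + blinfun_apply b h + e * norm h"
    by blast
  \<comment> \<open>Minimality of \<open>z\<close> bounds \<open>xs h\<close> by the increments of
    the two smooth parts, whose slopes are \<open>\<eta>1\<close> times \<open>a0\<close>, and
    \<open>b\<close>; what is left of \<open>xs\<close> is the normal.\<close>
  define a where "a = xs - \<eta>1 *\<^sub>R a0 - b"
  have "a \<in> frechet_normal_cone (A \<inter> closure C) z"
    unfolding frechet_normal_cone_def frechet_eps_normals_iff
  proof safe
    fix e :: real assume e: "0 < e"
    define e1 where "e1 = e / (2 * \<eta>1)"
    have e1: "0 < e1" "\<eta>1 * e1 = e / 2" using e pos by (simp_all add: e1_def)
    obtain \<delta>1 where \<delta>1: "0 < \<delta>1" "\<And>h. norm h < \<delta>1 \<Longrightarrow> H h \<Longrightarrow>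
        p s (z - x + h) \<le> p s (z - x) + blinfun_apply a0 h + e1 * norm h"
      using a0(2)[OF e1(1)] by blast
    obtain \<delta>2 where \<delta>2: "0 < \<delta>2" "\<And>h. norm h < \<delta>2 \<Longrightarrow> H h \<Longrightarrow>
        G h \<le> G 0 + blinfun_apply b h + (e / 2) * norm h"
      using b(2)[of "e / 2"] e by auto
    have "a (w - z) \<le> e * norm (w - z)" if w: "w \<in> S" "dist w z < min \<delta>1 \<delta>2" for w
    proof -
      define h where "h = w - z"
      have h: "norm h < \<delta>1" "norm h < \<delta>2" "H h"
        using w H z(1) by (auto simp: h_def dist_norm)
      have "\<eta>1 * p s (z - x + h) \<le> \<eta>1 * (p s (z - x) + a0 h + e1 * norm h)"
        using \<delta>1(2)[OF h(1,3)] pos by (intro mult_left_mono) auto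
      also have "\<dots> = \<eta>1 * p s (z - x) + \<eta>1 * a0 h + (e / 2) * norm h"
        using e1(2) by (simp add: distrib_left mult.assoc[symmetric])
      finally have 1: "\<eta>1 * p s (w - x) \<le> \<eta>1 * p s (z - x) + \<eta>1 * a0 h + (e / 2) * norm h"
        by (simp add: h_def algebra_simps)
      have 2: "\<phi> z + G 0 \<le> \<phi> w + G h"
        using min[OF w(1)] by (simp add: I_def G_def h_def algebra_simps)
      have 3: "xs (w - x) = xs (z - x) + xs h"
        by (simp add: h_def blinfun.diff_right)
      have "a h = xs h - \<eta>1 * a0 h - b h"
        by (simp add: a_def blinfun.diff_left blinfun.scaleR_left)
      also have "\<dots> \<le> e * norm h"
        using 1 2 3 \<delta>2(2)[OF h(2,3)] unfolding \<phi>_def by (simp add: field_simps)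
      finally show ?thesis by (simp add: h_def)
    qed
    then show "\<exists>\<delta>>0. \<forall>w\<in>A \<inter> closure C. dist w z < \<delta> \<longrightarrow> a (w - z) \<le> e * norm (w - z)"
      using \<delta>1(1) \<delta>2(1) by (intro exI[of _ "min \<delta>1 \<delta>2"]) (auto simp: S_def)
  qed
  moreover have "norm (a - xs) \<le> \<eta> + \<gamma>"
  proof -
    have "a - xs = - (\<eta>1 *\<^sub>R a0 + b)" by (simp add: a_def)
    then have "norm (a - xs) = norm (\<eta>1 *\<^sub>R a0 + b)" by (metis norm_minus_cancel)
    also have "\<dots> \<le> \<eta>1 * norm a0 + norm b"
      using norm_triangle_ineq[of "\<eta>1 *\<^sub>R a0" b] pos by simp
    also have "\<dots> \<le> \<eta>1 * 1 + \<kappa>"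
      using a0(1) b(1) pos by (intro add_mono mult_left_mono) auto
    finally show ?thesis by (simp add: \<eta>1_def \<kappa>_def)
  qed
  moreover have "z \<in> A \<inter> closure C" using z(1) S(3) by (auto simp: S_def)
  ultimately obtain b' where "norm (b' - xs) \<le> \<eta> + \<gamma>" "b' \<in> frechet_normal_cone A z"
    using C(4) by blast
  moreover have "norm (z - x) < \<gamma>" using z(2) \<gamma> by (simp add: \<rho>_def)
  ultimately show ?thesis using that z(1) S(3) by blast
qed


section \<open>Localization of normals, and the equivalence\<close>

lemma frechet_eps_normals_local:
  assumes "open U" "x \<in> U" "xs \<in> frechet_eps_normals (A \<inter> U) e x"
  shows "xs \<in> frechet_eps_normals A e x"
  unfolding frechet_eps_normals_iff
proof safe
  fix \<eta> assume "e < \<eta>"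
  then obtain \<delta>1 where \<delta>1: "0 < \<delta>1" "\<forall>u\<in>A \<inter> U. dist u x < \<delta>1 \<longrightarrow> xs (u - x) \<le> \<eta> * norm (u - x)"
    using assms(3) unfolding frechet_eps_normals_iff by blast
  obtain \<delta>2 where \<delta>2: "0 < \<delta>2" "ball x \<delta>2 \<subseteq> U"
    using assms(1,2) by (meson openE)
  show "\<exists>\<delta>>0. \<forall>u\<in>A. dist u x < \<delta> \<longrightarrow> xs (u - x) \<le> \<eta> * norm (u - x)"
    using \<delta>1 \<delta>2 by (intro exI[of _ "min \<delta>1 \<delta>2"]) (auto simp: dist_commute subset_iff)
qed

lemma frechet_eps_normals_restrict:
  assumes "xs \<in> frechet_eps_normals A e x" "B \<subseteq> A"
  shows "xs \<in> frechet_eps_normals B e x"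
  using assms unfolding frechet_eps_normals_iff by (meson subsetD)

lemma frechet_normal_cone_subset:
  "0 \<le> e \<Longrightarrow> frechet_normal_cone A x \<subseteq> frechet_eps_normals A e x"
  unfolding frechet_normal_cone_def by (auto simp: frechet_eps_normals_iff)

lemma frechet_normal_cone_scale:
  assumes "a \<in> frechet_normal_cone A x" "0 < t"
  shows "t *\<^sub>R a \<in> frechet_normal_cone A x"
  unfolding frechet_normal_cone_def frechet_eps_normals_iff
proof safe
  fix \<eta> :: real assume "0 < \<eta>"
  then have "0 < \<eta> / t" using assms(2) by simp
  then obtain \<delta> where \<delta>: "0 < \<delta>" "\<And>u. u \<in> A \<Longrightarrow> dist u x < \<delta> \<Longrightarrow> blinfun_apply a (u - x) \<le> \<eta> / t * norm (u - x)"
    using frechet_normal_coneD[OF assms(1)] by metis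
  have "(t *\<^sub>R a) (u - x) \<le> \<eta> * norm (u - x)" if "u \<in> A" "dist u x < \<delta>" for u
    using mult_left_mono[OF \<delta>(2)[OF that], of t] assms(2) by (simp add: blinfun.scaleR_left)
  then show "\<exists>\<delta>>0. \<forall>u\<in>A. dist u x < \<delta> \<longrightarrow> (t *\<^sub>R a) (u - x) \<le> \<eta> * norm (u - x)"
    using \<delta>(1) by blast
qed

text \<open>On a small closed ball inside \<open>V\<close> the asymptotic inequality holds outright
  with tolerance \<open>e + \<gamma> / 2\<close>, and the set becomes closed.\<close>

lemma frechet_eps_normal_approx:
  fixes A :: "'a::banach set"
  assumes asp: "asplund_space TYPE('a)" and A: "closed (A \<inter> V)" "x \<in> A" "x \<in> interior V"
    and xs: "xs \<in> frechet_eps_normals A e x" and e: "0 \<le> e" and \<gamma>: "0 < \<gamma>"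
  obtains u a where "u \<in> A" "norm (u - x) < \<gamma>" "norm (a - xs) \<le> e + \<gamma>" "a \<in> frechet_normal_cone A u"
proof -
  obtain r1 where r1: "0 < r1" "\<And>u. u \<in> A \<Longrightarrow> dist u x < r1 \<Longrightarrow> xs (u - x) \<le> (e + \<gamma> / 2) * norm (u - x)"
    using xs[unfolded frechet_eps_normals_iff, rule_format, of "e + \<gamma> / 2"] \<gamma> by auto
  obtain r2 where r2: "0 < r2" "ball x r2 \<subseteq> V"
    using A(3) by (auto simp: mem_interior)
  define r where "r = min r1 r2 / 2"
  have r: "0 < r" "r < r1" "r < r2" using r1 r2 by (auto simp: r_def)
  define B where "B = A \<inter> cball x r"
  have "cball x r \<subseteq> V" using r r2(2) by (auto simp: subset_iff)
  then have "B = (A \<inter> V) \<inter> cball x r" by (auto simp: B_def)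
  then have "closed B" using A(1) by auto
  moreover have "x \<in> B" using A(2) r by (simp add: B_def)
  moreover have "xs (u - x) \<le> (e + \<gamma> / 2) * norm (u - x)" if "u \<in> B" for u
    using r1(2)[of u] that r by (auto simp: B_def dist_commute)
  \<comment> \<open>Half of \<gamma> went into the inequality. The bound by \<open>r\<close> keeps
    the new point in the open ball, where normals to \<open>B\<close> are normals to
    \<open>A\<close>.\<close>
  moreover have "0 \<le> e + \<gamma> / 2" "0 < min (\<gamma> / 2) r" using e \<gamma> r by auto
  ultimately obtain u a where ua: "u \<in> B" "norm (u - x) < min (\<gamma> / 2) r"
    "norm (a - xs) \<le> e + \<gamma> / 2 + min (\<gamma> / 2) r" "a \<in> frechet_normal_cone B u"
    using fuzzy_frechet_normal[OF asp] by metis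
  have "a \<in> frechet_eps_normals (A \<inter> ball x r) 0 u"
    using ua(4) unfolding frechet_normal_cone_def
    by (rule frechet_eps_normals_restrict) (auto simp: B_def)
  then have "a \<in> frechet_normal_cone A u"
    unfolding frechet_normal_cone_def
    by (rule frechet_eps_normals_local[rotated 2]) (use ua(2) in \<open>auto simp: dist_norm norm_minus_commute\<close>)
  moreover have "u \<in> A" using ua(1) by (simp add: B_def)
  ultimately show ?thesis using ua \<gamma> by (intro that[of u a]) auto
qed

theorem theorem4p2:
  fixes \<Omega> :: "'a::banach set" and xb :: 'a
  assumes "asplund_space TYPE('a)"
    and "xb \<in> \<Omega>"
    and "closed_around \<Omega> xb"
  shows "semismooth_star \<Omega> xb \<longleftrightarrow>
    (\<forall>\<epsilon>>0. \<exists>\<delta>>0. \<forall>x \<in> \<Omega> \<inter> ball xb \<delta>. \<forall>xs \<in> frechet_normal_cone \<Omega> x.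
       norm xs = 1 \<longrightarrow> \<bar>blinfun_apply xs (x - xb)\<bar> \<le> \<epsilon> * norm (x - xb))"
proof
  assume "semismooth_star \<Omega> xb"
  then show "\<forall>\<epsilon>>0. \<exists>\<delta>>0. \<forall>x \<in> \<Omega> \<inter> ball xb \<delta>. \<forall>xs \<in> frechet_normal_cone \<Omega> x.
       norm xs = 1 \<longrightarrow> \<bar>blinfun_apply xs (x - xb)\<bar> \<le> \<epsilon> * norm (x - xb)"
    unfolding semismooth_star_def using frechet_normal_cone_subset by (meson less_imp_le subsetD)
next
  assume R: "\<forall>\<epsilon>>0. \<exists>\<delta>>0. \<forall>x \<in> \<Omega> \<inter> ball xb \<delta>. \<forall>xs \<in> frechet_normal_cone \<Omega> x.
       norm xs = 1 \<longrightarrow> \<bar>blinfun_apply xs (x - xb)\<bar> \<le> \<epsilon> * norm (x - xb)"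
  obtain V where V: "closed (\<Omega> \<inter> V)" "xb \<in> interior V"
    using assms(3) by (auto simp: closed_around_def)
  obtain r where r: "0 < r" "ball xb r \<subseteq> interior V"
    using V(2) open_interior by (meson openE)
  show "semismooth_star \<Omega> xb"
    unfolding semismooth_star_def
  proof (intro allI impI)
    fix \<epsilon> :: real assume \<epsilon>: "0 < \<epsilon>"
    then have "0 < \<epsilon> / 8" by simp
    then obtain \<delta>0 where \<delta>0: "0 < \<delta>0" "\<And>x xs. x \<in> \<Omega> \<Longrightarrow> x \<in> ball xb \<delta>0 \<Longrightarrow> xs \<in> frechet_normal_cone \<Omega> x \<Longrightarrow>
        norm xs = 1 \<Longrightarrow> \<bar>blinfun_apply xs (x - xb)\<bar> \<le> \<epsilon> / 8 * norm (x - xb)"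
      using R by (metis Int_iff)
    \<comment> \<open>\<open>r\<close> keeps \<open>x\<close> where the set is closed,
      \<open>\<delta>0 / 2\<close> keeps \<open>u\<close> in the ball of the hypothesis, and
      \<open>1 / 4\<close> keeps \<open>norm a\<close> between 1/2 and 2. With
      \<open>\<epsilon> / 10\<close> the errors \<open>4 * \<delta> * n\<close> and
      \<open>\<delta> * n\<close> total half of \<open>\<epsilon> * n\<close>; the other half is
      \<open>\<epsilon> / 8\<close>, doubled for \<open>norm a\<close> and again for
      \<open>norm (u - xb)\<close>.\<close>
    define \<delta> where "\<delta> = Min {r, \<delta>0 / 2, 1 / 4, \<epsilon> / 10}"
    have \<delta>: "0 < \<delta>" "\<delta> \<le> r" "\<delta> \<le> \<delta>0 / 2" "\<delta> \<le> 1 / 4" "\<delta> \<le> \<epsilon> / 10"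
      using r(1) \<delta>0(1) \<epsilon> by (auto simp: \<delta>_def)
    have "\<bar>blinfun_apply xs (x - xb)\<bar> \<le> \<epsilon> * norm (x - xb)"
      if x: "x \<in> \<Omega>" "x \<in> ball xb \<delta>" and xs: "xs \<in> frechet_eps_normals \<Omega> \<delta> x" "norm xs = 1" for x xs
    proof (cases "x = xb")
      case False
      define n where "n = norm (x - xb)"
      have n: "0 < n" "n < \<delta>"
        using False x(2) by (auto simp: n_def dist_norm norm_minus_commute)
      have "x \<in> interior V" using x(2) \<delta>(2) r(2) by (auto simp: subset_iff)
      \<comment> \<open>The factor \<open>n\<close> makes \<open>u\<close> close to \<open>x\<close>
        relative to the distance from \<open>xb\<close>, so that \<open>norm (u - xb)\<close> is at
        most \<open>2 * n\<close>; the minimum with 1 keeps \<open>a\<close> within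
        \<open>2 * \<delta>\<close> of \<open>xs\<close>.\<close>
      moreover have "0 < \<delta> * min 1 n" using \<delta>(1) n(1) by simp
      ultimately obtain u a where u: "u \<in> \<Omega>" "norm (u - x) < \<delta> * min 1 n"
        "norm (a - xs) \<le> \<delta> + \<delta> * min 1 n" "a \<in> frechet_normal_cone \<Omega> u"
        using frechet_eps_normal_approx[OF assms(1) V(1) x(1) _ xs(1)] \<delta>(1) by (metis less_imp_le)
      have "\<delta> * min 1 n \<le> \<delta> * 1" "\<delta> * min 1 n \<le> \<delta> * n"
        using \<delta>(1) by (intro mult_left_mono; simp)+
      then have ux: "norm (u - x) \<le> \<delta>" "norm (u - x) \<le> \<delta> * n" and ax: "norm (a - xs) \<le> 2 * \<delta>"
        using u(2,3) by auto
      have a: "1 / 2 \<le> norm a" "norm a \<le> 2"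
        using norm_triangle_ineq2[of xs a] norm_triangle_ineq2[of a xs] ax xs(2) \<delta>(4)
        by (auto simp: norm_minus_commute)
      then have a_pos: "0 < norm a" by linarith
      have "\<delta> * n \<le> 1 * n" using \<delta>(4) n(1) by (intro mult_right_mono) auto
      then have uxb: "norm (u - xb) \<le> 2 * n"
        using norm_triangle_ineq[of "u - x" "x - xb"] ux(2) by (simp add: n_def)
      have "norm (u - xb) < \<delta>0"
        using norm_triangle_ineq[of "u - x" "x - xb"] ux(1) n(2) \<delta>(3) by (simp add: n_def)
      then have "u \<in> ball xb \<delta>0" by (simp add: dist_norm norm_minus_commute)
      \<comment> \<open>The hypothesis speaks of unit normals, so \<open>a\<close> is rescaled
        within the cone.\<close>
      moreover have "(1 / norm a) *\<^sub>R a \<in> frechet_normal_cone \<Omega> u"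
        using a_pos by (intro frechet_normal_cone_scale[OF u(4)]) simp
      moreover have "norm ((1 / norm a) *\<^sub>R a) = 1" using a_pos by simp
      ultimately have "\<bar>((1 / norm a) *\<^sub>R a) (u - xb)\<bar> \<le> \<epsilon> / 8 * norm (u - xb)"
        using \<delta>0(2)[OF u(1)] by blast
      also have "\<dots> \<le> \<epsilon> / 8 * (2 * n)" using uxb \<epsilon> by (intro mult_left_mono) auto
      finally have "\<bar>a (u - xb)\<bar> / norm a \<le> \<epsilon> / 4 * n"
        by (simp add: blinfun.scaleR_left abs_mult)
      then have "\<bar>a (u - xb)\<bar> \<le> norm a * (\<epsilon> / 4 * n)"
        using a_pos by (simp add: pos_divide_le_eq mult.commute)
      also have "\<dots> \<le> 2 * (\<epsilon> / 4 * n)" using a(2) \<epsilon> n(1) by (intro mult_right_mono) auto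
      finally have 1: "\<bar>a (u - xb)\<bar> \<le> \<epsilon> / 2 * n" by simp
      have "\<bar>(a - xs) (u - xb)\<bar> \<le> norm (a - xs) * norm (u - xb)"
        using norm_blinfun[of "a - xs" "u - xb"] by simp
      also have "\<dots> \<le> (2 * \<delta>) * (2 * n)" using ax uxb \<delta>(1) by (intro mult_mono) auto
      finally have 2: "\<bar>(a - xs) (u - xb)\<bar> \<le> 4 * (\<delta> * n)" by simp
      have 3: "\<bar>xs (u - x)\<bar> \<le> \<delta> * n"
        using norm_blinfun[of xs "u - x"] xs(2) ux(2) by simp
      have 4: "\<delta> * n \<le> \<epsilon> / 10 * n" using \<delta>(5) n(1) by (intro mult_right_mono) auto
      have "xs (x - xb) = a (u - xb) - (a - xs) (u - xb) - xs (u - x)"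
        by (simp add: blinfun.diff_left blinfun.diff_right)
      then have "\<bar>xs (x - xb)\<bar> \<le> \<bar>a (u - xb)\<bar> + \<bar>(a - xs) (u - xb)\<bar> + \<bar>xs (u - x)\<bar>"
        by linarith
      also have "\<dots> \<le> \<epsilon> * n" using 1 2 3 4 by (simp add: field_simps)
      finally show ?thesis by (simp add: n_def)
    qed simp
    then show "\<exists>\<delta>>0. \<forall>x\<in>\<Omega> \<inter> ball xb \<delta>. \<forall>xs\<in>frechet_eps_normals \<Omega> \<delta> x. norm xs = 1 \<longrightarrow>
        \<bar>blinfun_apply xs (x - xb)\<bar> \<le> \<epsilon> * norm (x - xb)"
      using \<delta>(1) by blast
  qed
qed

end
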